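(* There exists a deterministic algorithm solving $(m-k)$-Hitting Set in time $O\big((2e)^{2k+O(\log^2 k)}(m+n)^{O(1)}\big)$, where $e$ is the base of the natural logarithm.
   Context: A hypergraph $H$ consists of a nonempty finite vertex set $V(H)$ and a family $E(H)$ of nonempty subsets of $V(H)$ (edges), where parallel (repeated) edges are allowed. A set $S\subseteq V(H)$ is a hitting set if $e\cap S\neq\emptyset$ for every edge $e\in E(H)$. The problem $(m-k)$-Hitting Set: given a hypergraph $H$ with $n=|V(H)|$ and $m=|E(H)|$ (counted with multiplicity) and a positive integer $k$ (the parameter), decide whether $H$ has a hitting set of size at most $m-k$. *)

theory Defs
  imports Complex_Main "HOL-Library.Multiset" "HOL-Library.Log_Nat" "HOL-Library.Landau_Symbols"
begin

locale hypergraph =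
  fixes V :: "'a set" and E :: "'a set multiset"
  assumes finite_vertices: "finite V"
    and vertices_nonempty: "V \<noteq> {}"
    and edge_nonempty: "e \<in># E \<Longrightarrow> e \<noteq> {}"
    and edge_subset: "e \<in># E \<Longrightarrow> e \<subseteq> V"

definition hitting_set :: "'a set \<Rightarrow> 'a set multiset \<Rightarrow> 'a set \<Rightarrow> bool" where
  "hitting_set V E S \<longleftrightarrow> S \<subseteq> V \<and> (\<forall>e \<in># E. e \<inter> S \<noteq> {})"

text \<open>The size bound is a difference of integers, so that an instance with
  \<open>size E < k\<close> is a no-instance.\<close>

definition m_minus_k_hitting_set :: "'a set \<Rightarrow> 'a set multiset \<Rightarrow> nat \<Rightarrow> bool" where
  "m_minus_k_hitting_set V E k \<longleftrightarrow>
     (\<exists>S. hitting_set V E S \<and> int (card S) \<le> int (size E) - int k)"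

text \<open>
  Algorithms are structured programs for a random access machine with addition, truncated
  subtraction and halving, under the logarithmic cost measure. The memory of the machine
  is divided into named arrays of natural numbers. A program mentions only finitely many of
  them, so they can be interleaved in a single memory; a scalar is cell 0 of an array.
  Under logarithmic cost neither long numbers nor far addresses are free.
\<close>

type_synonym mem = "string \<Rightarrow> nat \<Rightarrow> nat"

datatype aexp =
    Const nat
  | Read string aexp
  | Add aexp aexp
  | Sub aexp aexp
  | Half aexp

fun aval :: "aexp \<Rightarrow> mem \<Rightarrow> nat" where
  "aval (Const c) s = c"
| "aval (Read x a) s = s x (aval a s)"
| "aval (Add a b) s = aval a s + aval b s"
| "aval (Sub a b) s = aval a s - aval b s"
| "aval (Half a) s = aval a s div 2"

definition log_cost :: "nat \<Rightarrow> nat" where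
  "log_cost n = 1 + floorlog 2 n"

text \<open>Every node of an expression is charged for its own value. The operands of an
  operation, and the address of a read, are thus charged by the respective subexpressions.\<close>

fun acost :: "aexp \<Rightarrow> mem \<Rightarrow> nat" where
  "acost (Const c) s = log_cost c"
| "acost (Read x a) s = acost a s + log_cost (s x (aval a s))"
| "acost (Add a b) s = acost a s + acost b s + log_cost (aval a s + aval b s)"
| "acost (Sub a b) s = acost a s + acost b s + log_cost (aval a s - aval b s)"
| "acost (Half a) s = acost a s + log_cost (aval a s div 2)"

datatype com =
    Skip
  | Write string aexp aexp
  | Seq com com
  | Cond aexp com com
  | While aexp com

text \<open>\<open>exec c s t s'\<close>: started in memory \<open>s\<close>, the program \<open>c\<close> terminates in memory \<open>s'\<close>
  at total cost \<open>t\<close>. A test succeeds iff its value is nonzero.\<close>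

inductive exec :: "com \<Rightarrow> mem \<Rightarrow> nat \<Rightarrow> mem \<Rightarrow> bool" where
  Skip: "exec Skip s 1 s"
| Write: "exec (Write x i a) s (1 + acost i s + acost a s) (s(x := (s x)(aval i s := aval a s)))"
| Seq: "exec c1 s t1 s1 \<Longrightarrow> exec c2 s1 t2 s2 \<Longrightarrow> exec (Seq c1 c2) s (t1 + t2) s2"
| CondTrue: "aval b s \<noteq> 0 \<Longrightarrow> exec c1 s t s' \<Longrightarrow> exec (Cond b c1 c2) s (1 + acost b s + t) s'"
| CondFalse: "aval b s = 0 \<Longrightarrow> exec c2 s t s' \<Longrightarrow> exec (Cond b c1 c2) s (1 + acost b s + t) s'"
| WhileFalse: "aval b s = 0 \<Longrightarrow> exec (While b c) s (1 + acost b s) s"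
| WhileTrue: "aval b s \<noteq> 0 \<Longrightarrow> exec c s t1 s1 \<Longrightarrow> exec (While b c) s1 t2 s2 \<Longrightarrow>
    exec (While b c) s (1 + acost b s + t1 + t2) s2"

inductive_cases SkipE: "exec Skip s t s'"
inductive_cases WriteE: "exec (Write x i a) s t s'"
inductive_cases SeqE: "exec (Seq c1 c2) s t s'"
inductive_cases CondE: "exec (Cond b c1 c2) s t s'"
inductive_cases WhileE: "exec (While b c) s t s'"

lemma exec_deterministic:
  "exec c s t s' \<Longrightarrow> exec c s u s'' \<Longrightarrow> t = u \<and> s' = s''"
proof (induction arbitrary: u s'' rule: exec.induct)
  case (Skip s)
  then show ?case by (elim SkipE) simp
next
  case (Write x i a s)
  then show ?case by (elim WriteE) simp
next
  case (Seq c1 s t1 s1 c2 t2 s2)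
  from Seq.prems obtain t1' s1' t2' where
    "u = t1' + t2'" "exec c1 s t1' s1'" "exec c2 s1' t2' s''"
    by (rule SeqE)
  with Seq.IH(1)[of t1' s1'] Seq.IH(2)[of t2' s''] show ?case by simp
next
  case (CondTrue b s c1 t s' c2)
  from CondTrue.prems CondTrue.hyps(1) obtain t' where
    "u = 1 + acost b s + t'" "exec c1 s t' s''"
    by (elim CondE) auto
  with CondTrue.IH[of t' s''] show ?case by simp
next
  case (CondFalse b s c2 t s' c1)
  from CondFalse.prems CondFalse.hyps(1) obtain t' where
    "u = 1 + acost b s + t'" "exec c2 s t' s''"
    by (elim CondE) auto
  with CondFalse.IH[of t' s''] show ?case by simp
next
  case (WhileFalse b s c)
  from WhileFalse.prems show ?case by (rule WhileE) (use WhileFalse.hyps in auto)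
next
  case (WhileTrue b s c t1 s1 t2 s2)
  from WhileTrue.prems obtain t1' s1' t2' where
    "u = 1 + acost b s + t1' + t2'" "exec c s t1' s1'" "exec (While b c) s1' t2' s''"
    by (rule WhileE) (use WhileTrue.hyps(1) in auto)
  with WhileTrue.IH(1)[of t1' s1'] WhileTrue.IH(2)[of t2' s''] show ?case by simp
qed

text \<open>An instance is presented by its numbers \<open>n\<close> and \<open>m\<close> of vertices and edges, the parameter
  \<open>k\<close>, and the incidence matrix, stored with one row of length \<open>n\<close> for each edge. All other
  cells are 0.\<close>

definition encode :: "'a list \<Rightarrow> 'a set list \<Rightarrow> nat \<Rightarrow> mem" where
  "encode vs es k =
     (\<lambda>_ _. 0)
       (''n'' := (\<lambda>_. 0)(0 := length vs),
        ''m'' := (\<lambda>_. 0)(0 := length es),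
        ''k'' := (\<lambda>_. 0)(0 := k),
        ''inc'' := (\<lambda>p. if p < length es * length vs \<and>
                           vs ! (p mod length vs) \<in> es ! (p div length vs) then 1 else 0))"

definition represents :: "mem \<Rightarrow> 'a set \<Rightarrow> 'a set multiset \<Rightarrow> nat \<Rightarrow> bool" where
  "represents s V E k \<longleftrightarrow>
     (\<exists>vs es. distinct vs \<and> set vs = V \<and> mset es = E \<and> s = encode vs es k)"

definition answers :: "com \<Rightarrow> mem \<Rightarrow> bool \<Rightarrow> nat \<Rightarrow> bool" where
  "answers p s b t \<longleftrightarrow> (\<exists>s'. exec p s t s' \<and> s' ''out'' 0 = (if b then 1 else 0))"

end

theory Submission
  imports Defs "HOL-Library.Nat_Bijection" "HOL-Combinatorics.Permutations"
begin

text \<open>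
  One greedy pass over the vertices accepts every vertex that hits at least two edges not hit
  so far. If \<open>c\<close> edges are hit by the accepted vertices, these are at most \<open>c / 2\<close> vertices;
  hitting every other edge separately gives a hitting set of size at most \<open>m - c / 2\<close>,
  which settles the case \<open>c \<ge> 2 * k\<close>. Otherwise every vertex hits at most one of the
  remaining \<open>m - c\<close> edges, so that removing the edges of a vertex from a set
  \<open>X \<union> {c..<i}\<close> with \<open>X \<subseteq> {..<c}\<close> and \<open>c < i\<close>, where the vertex is chosen in edge
  \<open>i - 1\<close>, leaves a set of the form \<open>X' \<union> {c..<i - 1}\<close>. Dynamic programming over these sets
  needs \<open>4 ^ k * (m + n) ^ O(1)\<close> steps. A step increases the length of the longest number in
  the memory by at most a constant, hence \<open>N\<close> steps cost \<open>O(N * (N + m + n + k))\<close>, and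
  \<open>16 ^ k \<le> (2 * exp 1) powr (2 * k)\<close>.
\<close>

subsection \<open>Counting steps instead of logarithmic cost\<close>

text \<open>The target leaves slack: (2e)^2 > 29 > 16. The passage from steps to logarithmic cost
  may therefore be crude: bounding every bit length linearly in the input and the number of steps
  squares 4^k, and the result still fits with the zero function as \<open>g\<close>. A vertex
  rejected by the greedy pass hits at most one edge that is unhit at its turn, and this persists
  because the unhit set only shrinks. So the edges left over are pairwise disjoint, which collapses
  the 2^m subsets that branching might reach to 2^c masks times m - c + 1 intervals; c < 2k turns
  2^c into 4^k. The machine has no multiplication and no bit operations. Edge subsets are numbers
  read by repeated halving, matrix rows are addressed through precomputed offsets, and edges are
  reordered by permuting these offsets, so that the greedily hit edges become the c low
  bits.\<close>

inductive steps :: "com \<Rightarrow> mem \<Rightarrow> nat \<Rightarrow> mem \<Rightarrow> bool" where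
  Skip: "steps Skip s 1 s"
| Write: "steps (Write x i a) s 1 (s(x := (s x)(aval i s := aval a s)))"
| Seq: "steps c1 s t1 s1 \<Longrightarrow> steps c2 s1 t2 s2 \<Longrightarrow> steps (Seq c1 c2) s (t1 + t2) s2"
| CondTrue: "aval b s \<noteq> 0 \<Longrightarrow> steps c1 s t s' \<Longrightarrow> steps (Cond b c1 c2) s (1 + t) s'"
| CondFalse: "aval b s = 0 \<Longrightarrow> steps c2 s t s' \<Longrightarrow> steps (Cond b c1 c2) s (1 + t) s'"
| WhileFalse: "aval b s = 0 \<Longrightarrow> steps (While b c) s 1 s"
| WhileTrue: "aval b s \<noteq> 0 \<Longrightarrow> steps c s t1 s1 \<Longrightarrow> steps (While b c) s1 t2 s2 \<Longrightarrow>
    steps (While b c) s (1 + t1 + t2) s2"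

text \<open>A constant counts with its value, so that one number bounds both how many nodes are
  charged and, as an exponent of 2, the growth of values.\<close>

fun asize :: "aexp \<Rightarrow> nat" where
  "asize (Const c) = c + 1"
| "asize (Read x a) = asize a + 1"
| "asize (Add a b) = asize a + asize b + 1"
| "asize (Sub a b) = asize a + asize b + 1"
| "asize (Half a) = asize a + 1"

fun csize :: "com \<Rightarrow> nat" where
  "csize Skip = 0"
| "csize (Write x i a) = asize i + asize a"
| "csize (Seq c1 c2) = csize c1 + csize c2"
| "csize (Cond b c1 c2) = asize b + csize c1 + csize c2"
| "csize (While b c) = asize b + csize c"

text \<open>Apart from constants, which \<open>asize\<close> counts by value, only
  \<open>Add\<close> can exceed its operands and the memory, and it at most doubles the larger
  bound. A read is bounded by the memory whatever its address.\<close>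

lemma aval_le_pow2:
  assumes "\<And>x i. s x i \<le> 2 ^ b"
  shows "aval a s \<le> 2 ^ (b + asize a)"
proof (induction a)
  case (Const c)
  have "c \<le> 2 ^ c"
    by (simp add: less_imp_le)
  also have "\<dots> \<le> 2 ^ (b + asize (Const c))"
    by (intro power_increasing) auto
  finally show ?case by simp
next
  case (Read x a)
  have "s x (aval a s) \<le> 2 ^ b"
    by (rule assms)
  also have "\<dots> \<le> 2 ^ (b + asize (Read x a))"
    by (intro power_increasing) auto
  finally show ?case by simp
next
  case (Add a1 a2)
  have "(2::nat) ^ (b + asize a1) \<le> 2 ^ (b + asize a1 + asize a2)"
    "(2::nat) ^ (b + asize a2) \<le> 2 ^ (b + asize a1 + asize a2)"
    by (intro power_increasing; simp)+
  with Add have "aval a1 s + aval a2 s \<le> 2 * 2 ^ (b + asize a1 + asize a2)"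
    by linarith
  then show ?case
    by (simp add: add.assoc)
next
  case (Sub a1 a2)
  have "(2::nat) ^ (b + asize a1) \<le> 2 ^ (b + asize (Sub a1 a2))"
    by (intro power_increasing) auto
  with Sub(1) show ?case by simp
next
  case (Half a)
  have "(2::nat) ^ (b + asize a) \<le> 2 ^ (b + asize (Half a))"
    by (intro power_increasing) auto
  with Half show ?case by simp
qed

lemma log_cost_le:
  assumes "v \<le> 2 ^ B"
  shows "log_cost v \<le> 2 + B"
proof -
  have "v < 2 ^ Suc B"
    using assms by (simp add: order.strict_trans1)
  then have "floorlog 2 v \<le> Suc B"
    by (intro floorlog_leI) auto
  then show ?thesis
    by (simp add: log_cost_def)
qed

text \<open>There are at most \<open>asize a\<close> charges, and each is for a value of at most
  \<open>2 ^ (b + W)\<close>.\<close>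

lemma acost_le:
  assumes "\<And>x i. s x i \<le> 2 ^ b" and "asize a \<le> W"
  shows "acost a s \<le> asize a * (2 + b + W)"
proof -
  have lc: "log_cost (aval a s) \<le> 2 + b + W" if "asize a \<le> W" for a
  proof -
    have "aval a s \<le> 2 ^ (b + asize a)"
      by (rule aval_le_pow2) (rule assms)
    also have "\<dots> \<le> 2 ^ (b + W)"
      using that by (intro power_increasing) auto
    finally show ?thesis
      using log_cost_le by fastforce
  qed
  show ?thesis
    using assms(2)
  proof (induction a)
    case (Const c)
    then show ?case using lc[of "Const c"] by simp
  next
    case (Read x a)
    then show ?case using lc[of "Read x a"] by (simp add: algebra_simps)
  next
    case (Add a1 a2)
    then show ?case using lc[of "Add a1 a2"] by (simp add: algebra_simps)
  next
    case (Sub a1 a2)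
    then show ?case using lc[of "Sub a1 a2"] by (simp add: algebra_simps)
  next
    case (Half a)
    then show ?case using lc[of "Half a"] by (simp add: algebra_simps)
  qed
qed

lemma cost_step_le:
  assumes "a \<le> D" and "u \<le> t * (1 + D)"
  shows "1 + a + u \<le> (1 + t) * (1 + D :: nat)"
  using add_mono[OF assms] by (simp add: add_mult_distrib)

text \<open>The exponent \<open>b\<close> bounds the current memory and grows by at most
  \<open>W\<close> per step, so it is generalized in the induction. \<open>B\<close> is a fixed cap
  for the whole run, which makes the charge per step uniform.\<close>

lemma steps_imp_exec:
  assumes "steps c s N s'" and "csize c \<le> W" and "\<And>x i. s x i \<le> 2 ^ b" and "b + N * W \<le> B"
  shows "(\<exists>t. exec c s t s' \<and> t \<le> N * (1 + W * (2 + B + W))) \<and> (\<forall>x i. s' x i \<le> 2 ^ (b + N * W))"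
  using assms
proof (induction arbitrary: b rule: steps.induct)
  case (Skip s)
  have "s x i \<le> 2 ^ (b + 1 * W)" for x i
    using Skip(2)[of x i] by (rule order.trans) (simp add: power_increasing)
  moreover have "exec Skip s 1 s"
    by (rule exec.Skip)
  moreover have "1 \<le> 1 * (1 + W * (2 + B + W))"
    by simp
  ultimately show ?case by blast
next
  case (Write x i a s)
  have "acost i s \<le> asize i * (2 + b + W)" "acost a s \<le> asize a * (2 + b + W)"
    using acost_le[OF Write(2), of _ W] Write(1) by auto
  then have "acost i s + acost a s \<le> (asize i + asize a) * (2 + b + W)"
    by (simp add: algebra_simps)
  also have "\<dots> \<le> W * (2 + B + W)"
    using Write(1,3) by (intro mult_le_mono) auto
  finally have "1 + acost i s + acost a s \<le> 1 * (1 + W * (2 + B + W))"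
    by simp
  moreover have "(s(x := (s x)(aval i s := aval a s))) y j \<le> 2 ^ (b + 1 * W)" for y j
  proof -
    have "s y j \<le> 2 ^ (b + W)"
      using Write(2)[of y j] by (rule order.trans) (simp add: power_increasing)
    moreover have "aval a s \<le> 2 ^ (b + W)"
      using aval_le_pow2[OF Write(2), of a] by (rule order.trans) (use Write(1) in \<open>simp add: power_increasing\<close>)
    ultimately show ?thesis by auto
  qed
  ultimately show ?case
    using exec.Write by blast
next
  case (Seq c1 s t1 s1 c2 t2 s2)
  obtain t where t: "exec c1 s t s1" "t \<le> t1 * (1 + W * (2 + B + W))"
    and s1: "\<And>x i. s1 x i \<le> 2 ^ (b + t1 * W)"
    using Seq.IH(1)[of b] Seq.prems by (auto simp: algebra_simps)
  obtain t' where t': "exec c2 s1 t' s2" "t' \<le> t2 * (1 + W * (2 + B + W))"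
    and s2: "\<And>x i. s2 x i \<le> 2 ^ (b + t1 * W + t2 * W)"
    using Seq.IH(2)[of "b + t1 * W"] s1 Seq.prems by (auto simp: algebra_simps)
  have "exec (Seq c1 c2) s (t + t') s2"
    using t t' by (blast intro: exec.Seq)
  moreover have "t + t' \<le> (t1 + t2) * (1 + W * (2 + B + W))"
    using add_mono[OF t(2) t'(2)] by (simp only: add_mult_distrib)
  ultimately show ?case
    using s2 by (auto simp: add_mult_distrib add.assoc)
next
  case (CondTrue e s c1 t s' c2)
  obtain u where u: "exec c1 s u s'" "u \<le> t * (1 + W * (2 + B + W))"
    and s': "\<And>x i. s' x i \<le> 2 ^ (b + t * W)"
    using CondTrue.IH[of b] CondTrue.prems by (auto simp: algebra_simps)
  have "acost e s \<le> asize e * (2 + b + W)"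
    using CondTrue.prems by (intro acost_le) auto
  also have "\<dots> \<le> W * (2 + B + W)"
    using CondTrue.prems by (intro mult_le_mono) auto
  finally have "1 + acost e s + u \<le> (1 + t) * (1 + W * (2 + B + W))"
    using u(2) by (rule cost_step_le)
  moreover have "exec (Cond e c1 c2) s (1 + acost e s + u) s'"
    using CondTrue.hyps u by (blast intro: exec.CondTrue)
  moreover have "s' x i \<le> 2 ^ (b + (1 + t) * W)" for x i
    using s'[of x i] by (rule order.trans) (simp add: power_increasing)
  ultimately show ?case by blast
next
  case (CondFalse e s c2 t s' c1)
  obtain u where u: "exec c2 s u s'" "u \<le> t * (1 + W * (2 + B + W))"
    and s': "\<And>x i. s' x i \<le> 2 ^ (b + t * W)"
    using CondFalse.IH[of b] CondFalse.prems by (auto simp: algebra_simps)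
  have "acost e s \<le> asize e * (2 + b + W)"
    using CondFalse.prems by (intro acost_le) auto
  also have "\<dots> \<le> W * (2 + B + W)"
    using CondFalse.prems by (intro mult_le_mono) auto
  finally have "1 + acost e s + u \<le> (1 + t) * (1 + W * (2 + B + W))"
    using u(2) by (rule cost_step_le)
  moreover have "exec (Cond e c1 c2) s (1 + acost e s + u) s'"
    using CondFalse.hyps u by (blast intro: exec.CondFalse)
  moreover have "s' x i \<le> 2 ^ (b + (1 + t) * W)" for x i
    using s'[of x i] by (rule order.trans) (simp add: power_increasing)
  ultimately show ?case by blast
next
  case (WhileFalse e s c)
  have "acost e s \<le> asize e * (2 + b + W)"
    using WhileFalse.prems by (intro acost_le) auto
  also have "\<dots> \<le> W * (2 + B + W)"
    using WhileFalse.prems by (intro mult_le_mono) auto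
  finally have "1 + acost e s \<le> 1 * (1 + W * (2 + B + W))"
    by simp
  moreover have "exec (While e c) s (1 + acost e s) s"
    using WhileFalse.hyps by (rule exec.WhileFalse)
  moreover have "s x i \<le> 2 ^ (b + 1 * W)" for x i
    using WhileFalse.prems(2)[of x i] by (rule order.trans) (simp add: power_increasing)
  ultimately show ?case by blast
next
  case (WhileTrue e s c t1 s1 t2 s2)
  obtain t where t: "exec c s t s1" "t \<le> t1 * (1 + W * (2 + B + W))"
    and s1: "\<And>x i. s1 x i \<le> 2 ^ (b + t1 * W)"
    using WhileTrue.IH(1)[of b] WhileTrue.prems by (auto simp: algebra_simps)
  obtain t' where t': "exec (While e c) s1 t' s2" "t' \<le> t2 * (1 + W * (2 + B + W))"
    and s2: "\<And>x i. s2 x i \<le> 2 ^ (b + t1 * W + t2 * W)"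
    using WhileTrue.IH(2)[of "b + t1 * W"] s1 WhileTrue.prems by (auto simp: algebra_simps)
  have "acost e s \<le> asize e * (2 + b + W)"
    using WhileTrue.prems by (intro acost_le) auto
  also have "\<dots> \<le> W * (2 + B + W)"
    using WhileTrue.prems by (intro mult_le_mono) auto
  finally have "acost e s \<le> W * (2 + B + W)" .
  moreover have "t + t' \<le> (t1 + t2) * (1 + W * (2 + B + W))"
    using add_mono[OF t(2) t'(2)] by (simp only: add_mult_distrib)
  ultimately have "1 + acost e s + (t + t') \<le> (1 + (t1 + t2)) * (1 + W * (2 + B + W))"
    by (rule cost_step_le)
  then have "1 + acost e s + t + t' \<le> (1 + t1 + t2) * (1 + W * (2 + B + W))"
    by (simp only: add.assoc)
  moreover have "exec (While e c) s (1 + acost e s + t + t') s2"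
    using WhileTrue.hyps t t' by (blast intro: exec.WhileTrue)
  moreover have "s2 x i \<le> 2 ^ (b + (1 + t1 + t2) * W)" for x i
    using s2[of x i] by (rule order.trans) (intro power_increasing; simp add: add_mult_distrib)
  ultimately show ?case by blast
qed

subsection \<open>Total correctness with a step bound\<close>

text \<open>A weakest precondition with a budget. \<open>N\<close> is only an upper bound, so that
  branches of different length can share it.\<close>

definition terminates :: "com \<Rightarrow> mem \<Rightarrow> nat \<Rightarrow> (mem \<Rightarrow> bool) \<Rightarrow> bool" where
  "terminates c s N Q \<longleftrightarrow> (\<exists>t s'. steps c s t s' \<and> t \<le> N \<and> Q s')"

text \<open>The return to logarithmic cost. The bit lengths may grow with every one of the
  \<open>N\<close> steps, hence the bound quadratic in \<open>N\<close>.\<close>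

lemma terminates_imp_exec:
  assumes "terminates c s N Q" and "\<And>x i. s x i \<le> 2 ^ b"
  shows "\<exists>t s'. exec c s t s' \<and> t \<le> N * (1 + csize c * (2 + (b + N * csize c) + csize c)) \<and> Q s'"
proof -
  obtain u s' where u: "steps c s u s'" "u \<le> N" "Q s'"
    using assms(1) by (auto simp: terminates_def)
  obtain t where t: "exec c s t s'" "t \<le> u * (1 + csize c * (2 + (b + u * csize c) + csize c))"
    using steps_imp_exec[OF u(1) order.refl assms(2), of "b + u * csize c"] by auto
  have "u * (1 + csize c * (2 + (b + u * csize c) + csize c)) \<le> N * (1 + csize c * (2 + (b + N * csize c) + csize c))"
    using u(2) by (intro mult_le_mono add_mono order.refl)
  then show ?thesis
    using t u(3) order.trans by blast
qed

section \<open>Proof rules for programs with step budgets\<close>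

lemma terminates_mono:
  assumes "terminates c s N Q" and "\<And>s'. Q s' \<Longrightarrow> Q' s'" and "N \<le> N'"
  shows "terminates c s N' Q'"
  using assms unfolding terminates_def by (meson order.trans)

lemma terminates_Seq:
  assumes "terminates c1 s N1 (\<lambda>s'. terminates c2 s' N2 Q)" and "N1 + N2 \<le> N"
  shows "terminates (Seq c1 c2) s N Q"
  using assms unfolding terminates_def by (meson steps.Seq add_mono order.trans)

text \<open>This and the following equivalences let the simplifier execute straight-line code
  symbolically, paying one step each time. Only loops and subprograms need
  \<open>terminates_Seq\<close> with an explicit split of the budget.\<close>

lemma terminates_Skip [simp]: "terminates Skip s N Q \<longleftrightarrow> 0 < N \<and> Q s"
  unfolding terminates_def
  by (auto elim: steps.cases intro: steps.Skip intro!: exI[of _ 1] exI[of _ s])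

lemma terminates_Write [simp]:
  "terminates (Write x i a) s N Q \<longleftrightarrow> 0 < N \<and> Q (s(x := (s x)(aval i s := aval a s)))"
proof
  assume "terminates (Write x i a) s N Q"
  then show "0 < N \<and> Q (s(x := (s x)(aval i s := aval a s)))"
    unfolding terminates_def by (auto elim: steps.cases)
next
  assume "0 < N \<and> Q (s(x := (s x)(aval i s := aval a s)))"
  then show "terminates (Write x i a) s N Q"
    unfolding terminates_def using steps.Write by force
qed

lemma terminates_Cond [simp]:
  "terminates (Cond b c1 c2) s N Q \<longleftrightarrow>
     0 < N \<and> (if aval b s \<noteq> 0 then terminates c1 s (N - 1) Q else terminates c2 s (N - 1) Q)"
proof
  assume "terminates (Cond b c1 c2) s N Q"
  then obtain t s' where "steps (Cond b c1 c2) s t s'" "t \<le> N" "Q s'"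
    by (auto simp: terminates_def)
  then show "0 < N \<and> (if aval b s \<noteq> 0 then terminates c1 s (N - 1) Q else terminates c2 s (N - 1) Q)"
    unfolding terminates_def by cases (auto intro!: exI[of _ "t - 1"] exI[of _ s'])
next
  assume *: "0 < N \<and> (if aval b s \<noteq> 0 then terminates c1 s (N - 1) Q else terminates c2 s (N - 1) Q)"
  show "terminates (Cond b c1 c2) s N Q"
  proof (cases "aval b s = 0")
    case True
    with * obtain t s' where "steps c2 s t s'" "t \<le> N - 1" "Q s'"
      by (auto simp: terminates_def)
    moreover from this(1) have "steps (Cond b c1 c2) s (1 + t) s'"
      using True by (intro steps.CondFalse)
    moreover have "1 + t \<le> N" using * \<open>t \<le> N - 1\<close> by auto
    ultimately show ?thesis unfolding terminates_def by blast
  next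
    case False
    with * obtain t s' where "steps c1 s t s'" "t \<le> N - 1" "Q s'"
      by (auto simp: terminates_def)
    moreover from this(1) have "steps (Cond b c1 c2) s (1 + t) s'"
      using False by (intro steps.CondTrue)
    moreover have "1 + t \<le> N" using * \<open>t \<le> N - 1\<close> by auto
    ultimately show ?thesis unfolding terminates_def by blast
  qed
qed

lemma terminates_Seq_iff:
  "terminates (Seq c1 c2) s N Q \<longleftrightarrow>
     (\<exists>t1 s1 t2 s2. steps c1 s t1 s1 \<and> steps c2 s1 t2 s2 \<and> t1 + t2 \<le> N \<and> Q s2)"
proof
  assume "terminates (Seq c1 c2) s N Q"
  then obtain t s' where "steps (Seq c1 c2) s t s'" "t \<le> N" "Q s'"
    by (auto simp: terminates_def)
  then show "\<exists>t1 s1 t2 s2. steps c1 s t1 s1 \<and> steps c2 s1 t2 s2 \<and> t1 + t2 \<le> N \<and> Q s2"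
    by cases blast
qed (auto simp: terminates_def intro: steps.Seq)

text \<open>Reassociation to the right exposes the first atomic command to the simp rules for
  sequences.\<close>

lemma terminates_Seq_Seq [simp]:
  "terminates (Seq (Seq c1 c2) c3) s N Q \<longleftrightarrow> terminates (Seq c1 (Seq c2 c3)) s N Q"
proof
  assume "terminates (Seq (Seq c1 c2) c3) s N Q"
  then obtain t1 s1 t2 s2 where "steps (Seq c1 c2) s t1 s1" "steps c3 s1 t2 s2" "t1 + t2 \<le> N" "Q s2"
    unfolding terminates_Seq_iff by blast
  from this(1) obtain t3 s3 t4 where "steps c1 s t3 s3" "steps c2 s3 t4 s1" "t1 = t3 + t4"
    by cases blast
  then show "terminates (Seq c1 (Seq c2 c3)) s N Q"
    unfolding terminates_Seq_iff using \<open>steps c3 s1 t2 s2\<close> \<open>t1 + t2 \<le> N\<close> \<open>Q s2\<close>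
    by (metis steps.Seq add.assoc)
next
  assume "terminates (Seq c1 (Seq c2 c3)) s N Q"
  then obtain t1 s1 t2 s2 where "steps c1 s t1 s1" "steps (Seq c2 c3) s1 t2 s2" "t1 + t2 \<le> N" "Q s2"
    unfolding terminates_Seq_iff by blast
  from this(2) obtain t3 s3 t4 where "steps c2 s1 t3 s3" "steps c3 s3 t4 s2" "t2 = t3 + t4"
    by cases blast
  then show "terminates (Seq (Seq c1 c2) c3) s N Q"
    unfolding terminates_Seq_iff using \<open>steps c1 s t1 s1\<close> \<open>t1 + t2 \<le> N\<close> \<open>Q s2\<close>
    by (metis steps.Seq add.assoc)
qed

lemma terminates_Seq_nested:
  "terminates (Seq c1 c2) s N Q \<longleftrightarrow> (\<exists>t s'. steps c1 s t s' \<and> t \<le> N \<and> terminates c2 s' (N - t) Q)"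
  unfolding terminates_Seq_iff unfolding terminates_def
  by (smt (verit, best) add_leD1 le_diff_conv2 add.commute)

lemma terminates_Seq_Skip [simp]:
  "terminates (Seq Skip c) s N Q \<longleftrightarrow> 0 < N \<and> terminates c s (N - 1) Q"
  unfolding terminates_Seq_nested
  using terminates_Skip[of s N "\<lambda>s'. True"]
  by (auto elim: steps.cases intro: steps.Skip intro!: exI[of _ 1] exI[of _ s])

lemma terminates_Seq_Write [simp]:
  "terminates (Seq (Write x i a) c) s N Q \<longleftrightarrow>
     0 < N \<and> terminates c (s(x := (s x)(aval i s := aval a s))) (N - 1) Q"
proof
  assume "terminates (Seq (Write x i a) c) s N Q"
  then show "0 < N \<and> terminates c (s(x := (s x)(aval i s := aval a s))) (N - 1) Q"
    unfolding terminates_Seq_nested by (auto elim: steps.cases)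
next
  assume "0 < N \<and> terminates c (s(x := (s x)(aval i s := aval a s))) (N - 1) Q"
  then show "terminates (Seq (Write x i a) c) s N Q"
    unfolding terminates_Seq_nested using steps.Write by force
qed

lemma terminates_Seq_Cond [simp]:
  "terminates (Seq (Cond b c1 c2) c) s N Q \<longleftrightarrow>
     0 < N \<and> (if aval b s \<noteq> 0 then terminates (Seq c1 c) s (N - 1) Q
              else terminates (Seq c2 c) s (N - 1) Q)"
proof
  assume "terminates (Seq (Cond b c1 c2) c) s N Q"
  then obtain t s1 t2 s2 where *: "steps (Cond b c1 c2) s t s1" "steps c s1 t2 s2" "t + t2 \<le> N" "Q s2"
    unfolding terminates_Seq_iff by blast
  from *(1) have "\<exists>d u. t = 1 + u \<and> steps d s u s1 \<and> d = (if aval b s \<noteq> 0 then c1 else c2)"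
    by cases auto
  then obtain u where u: "t = 1 + u" "steps (if aval b s \<noteq> 0 then c1 else c2) s u s1"
    by blast
  then have "terminates (Seq (if aval b s \<noteq> 0 then c1 else c2) c) s (N - 1) Q"
    unfolding terminates_Seq_iff using *(2-4) by fastforce
  then show "0 < N \<and> (if aval b s \<noteq> 0 then terminates (Seq c1 c) s (N - 1) Q
              else terminates (Seq c2 c) s (N - 1) Q)"
    using *(3) u(1) by (auto split: if_splits)
next
  assume *: "0 < N \<and> (if aval b s \<noteq> 0 then terminates (Seq c1 c) s (N - 1) Q
              else terminates (Seq c2 c) s (N - 1) Q)"
  define d where "d = (if aval b s \<noteq> 0 then c1 else c2)"
  from * have "terminates (Seq d c) s (N - 1) Q" by (simp add: d_def split: if_splits)
  then obtain t s1 t2 s2 where **: "steps d s t s1" "steps c s1 t2 s2" "t + t2 \<le> N - 1" "Q s2"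
    unfolding terminates_Seq_iff by blast
  have "steps (Cond b c1 c2) s (1 + t) s1"
    using **(1) by (cases "aval b s = 0") (auto simp: d_def simp del: One_nat_def plus_1_eq_Suc intro: steps.CondTrue steps.CondFalse)
  moreover have "1 + t + t2 \<le> N" using * **(3) by auto
  ultimately show "terminates (Seq (Cond b c1 c2) c) s N Q"
    unfolding terminates_Seq_iff using **(2,4) by blast
qed

text \<open>A rule for counting loops: the index of the invariant replaces a termination measure.
  Each of the \<open>hi - lo\<close> rounds pays for its test and its body; the leading 1 is the
  failing test.\<close>

lemma terminates_While:
  assumes "I lo s" and "lo \<le> hi"
    and "\<And>i s. lo \<le> i \<Longrightarrow> i < hi \<Longrightarrow> I i s \<Longrightarrow> aval b s \<noteq> 0"
    and "\<And>i s. lo \<le> i \<Longrightarrow> i < hi \<Longrightarrow> I i s \<Longrightarrow> terminates c s N (I (Suc i))"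
    and "\<And>s. I hi s \<Longrightarrow> aval b s = 0"
    and "\<And>s. I hi s \<Longrightarrow> Q s"
    and "1 + (hi - lo) * (1 + N) \<le> N'"
  shows "terminates (While b c) s N' Q"
proof -
  \<comment> \<open>Induction on the number \<open>j\<close> of rounds still to run.\<close>
  have "terminates (While b c) s (1 + j * (1 + N)) (I hi)" if "I (hi - j) s" "j \<le> hi - lo" for j s
    using that
  proof (induction j arbitrary: s)
    case 0
    then have "steps (While b c) s 1 s"
      using assms(5) by (intro steps.WhileFalse) simp
    then show ?case
      using 0 unfolding terminates_def by force
  next
    case (Suc j)
    have hi: "lo \<le> hi - Suc j" "hi - Suc j < hi" "Suc (hi - Suc j) = hi - j"
      using Suc.prems(2) assms(2) by auto
    from assms(4)[OF hi(1,2) Suc.prems(1)] obtain t s1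
      where t: "steps c s t s1" "t \<le> N" "I (hi - j) s1"
      unfolding terminates_def hi(3) by blast
    obtain u s2 where u: "steps (While b c) s1 u s2" "u \<le> 1 + j * (1 + N)" "I hi s2"
      using Suc.IH[OF t(3)] Suc.prems(2) unfolding terminates_def by auto
    have "steps (While b c) s (1 + t + u) s2"
      using assms(3)[OF hi(1,2) Suc.prems(1)] t u by (intro steps.WhileTrue)
    moreover have "1 + t + u \<le> 1 + Suc j * (1 + N)"
      using t u by simp
    ultimately show ?case
      using u(3) unfolding terminates_def by blast
  qed
  from this[of "hi - lo" s] show ?thesis
    using assms(1,2,6,7) by (auto intro: terminates_mono)
qed

subsection \<open>Hitting numbers\<close>

text \<open>Edges are indices with an incidence relation, so parallel edges stay distinct and
  reordering the edges acts on the indices.\<close>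

definition hits :: "('j \<Rightarrow> 'v \<Rightarrow> bool) \<Rightarrow> 'v set \<Rightarrow> 'j set \<Rightarrow> 'v set \<Rightarrow> bool" where
  "hits A V Y S \<longleftrightarrow> S \<subseteq> V \<and> (\<forall>j\<in>Y. \<exists>v\<in>S. A j v)"

text \<open>Meaningful only if some hitting set exists, which the coverability hypotheses below
  guarantee. As \<open>card\<close> is 0 on infinite sets, deleting a vertex from an optimal set
  relies on a finite \<open>V\<close>.\<close>

definition hitting_number :: "('j \<Rightarrow> 'v \<Rightarrow> bool) \<Rightarrow> 'v set \<Rightarrow> 'j set \<Rightarrow> nat" where
  "hitting_number A V Y = (LEAST q. \<exists>S. hits A V Y S \<and> card S = q)"

lemma hitting_number_le: "hits A V Y S \<Longrightarrow> hitting_number A V Y \<le> card S"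
  unfolding hitting_number_def by (rule Least_le) blast

lemma hitting_number_attained:
  assumes "hits A V Y S"
  obtains T where "hits A V Y T" "card T = hitting_number A V Y"
proof -
  have "\<exists>q S. hits A V Y S \<and> card S = q"
    using assms by auto
  then have "\<exists>S. hits A V Y S \<and> card S = hitting_number A V Y"
    unfolding hitting_number_def by (rule LeastI_ex)
  then show thesis
    using that by auto
qed

lemma hits_all:
  assumes "\<And>j. j \<in> Y \<Longrightarrow> \<exists>v\<in>V. A j v"
  shows "hits A V Y V"
  using assms by (auto simp: hits_def)

lemma hitting_number_empty [simp]: "hitting_number A V {} = 0"
  using hitting_number_le[of A V "{}" "{}"] by (simp add: hits_def)

lemma hitting_number_le_card:
  assumes "finite Y" and "\<And>j. j \<in> Y \<Longrightarrow> \<exists>v\<in>V. A j v"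
  shows "hitting_number A V Y \<le> card Y"
proof -
  obtain f where "\<And>j. j \<in> Y \<Longrightarrow> f j \<in> V \<and> A j (f j)"
    using assms(2) by metis
  then have "hits A V Y (f ` Y)"
    by (auto simp: hits_def)
  then show ?thesis
    using hitting_number_le card_image_le[OF assms(1), of f] by (meson order.trans)
qed

text \<open>One half of the recurrence: \<open>v\<close> together with an optimal set for the edges
  avoiding \<open>v\<close> hits everything.\<close>

lemma hitting_number_step_le:
  assumes "finite V" and "\<And>j. j \<in> Y \<Longrightarrow> \<exists>v\<in>V. A j v" and "v \<in> V"
  shows "hitting_number A V Y \<le> 1 + hitting_number A V {j \<in> Y. \<not> A j v}"
proof -
  have "hits A V {j \<in> Y. \<not> A j v} V"
    using assms(2) by (intro hits_all) auto
  then obtain T where T: "hits A V {j \<in> Y. \<not> A j v} T" "card T = hitting_number A V {j \<in> Y. \<not> A j v}"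
    by (rule hitting_number_attained)
  then have "hits A V Y (insert v T)"
    using assms(3) by (auto simp: hits_def)
  then have "hitting_number A V Y \<le> card (insert v T)"
    by (rule hitting_number_le)
  also have "\<dots> \<le> 1 + card T"
    by (cases "finite T") (simp_all add: card_insert_if)
  finally show ?thesis using T(2) by simp
qed

text \<open>The other half: an optimal set meets edge \<open>j\<close> in some \<open>v\<close>, and
  without \<open>v\<close> it still hits the edges avoiding \<open>v\<close>. Hence the minimum may
  range over the vertices of one edge, and that edge may be chosen freely.\<close>

lemma hitting_number_step_attained:
  assumes "finite V" and "\<And>j. j \<in> Y \<Longrightarrow> \<exists>v\<in>V. A j v" and "j \<in> Y"
  obtains v where "v \<in> V" "A j v" "hitting_number A V Y = 1 + hitting_number A V {j \<in> Y. \<not> A j v}"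
proof -
  obtain T where T: "hits A V Y T" "card T = hitting_number A V Y"
    by (rule hitting_number_attained[OF hits_all[OF assms(2)]])
  then have "\<exists>v\<in>T. v \<in> V \<and> A j v"
    using assms(3) unfolding hits_def by blast
  then obtain v where v: "v \<in> T" "v \<in> V" "A j v"
    by blast
  have "hits A V {j \<in> Y. \<not> A j v} (T - {v})"
    using T(1) by (auto simp: hits_def)
  then have "hitting_number A V {j \<in> Y. \<not> A j v} \<le> card (T - {v})"
    by (rule hitting_number_le)
  moreover have "card T = Suc (card (T - {v}))"
    using v(1) T(1) finite_subset[OF _ assms(1), of T] by (intro card.remove) (auto simp: hits_def)
  ultimately have "1 + hitting_number A V {j \<in> Y. \<not> A j v} \<le> hitting_number A V Y"
    using T(2) by simp
  moreover have "hitting_number A V Y \<le> 1 + hitting_number A V {j \<in> Y. \<not> A j v}"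
    using assms(1,2) v(2) by (rule hitting_number_step_le)
  ultimately show thesis
    using v(2,3) by (intro that[of v]) simp_all
qed

text \<open>Every edge of \<open>Y\<close> gets a vertex of its own. With the greedily hit edges as
  \<open>Z\<close>, this settles instances without the table.\<close>

lemma hitting_number_le_add:
  assumes "finite Y" and "\<And>j. j \<in> Y \<Longrightarrow> \<exists>v\<in>V. A j v" and "hits A V Z S"
  shows "hitting_number A V (Z \<union> Y) \<le> card S + card Y"
proof -
  obtain f where "\<And>j. j \<in> Y \<Longrightarrow> f j \<in> V \<and> A j (f j)"
    using assms(2) by metis
  then have "hits A V (Z \<union> Y) (S \<union> f ` Y)"
    using assms(3) by (auto simp: hits_def)
  then have "hitting_number A V (Z \<union> Y) \<le> card (S \<union> f ` Y)"
    by (rule hitting_number_le)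
  also have "\<dots> \<le> card S + card (f ` Y)"
    by (rule card_Un_le)
  finally show ?thesis
    using card_image_le[OF assms(1), of f] by linarith
qed

lemma hitting_number_cong:
  assumes "\<And>j v. j \<in> Y \<Longrightarrow> v \<in> V \<Longrightarrow> A j v \<longleftrightarrow> B j v"
  shows "hitting_number A V Y = hitting_number B V Y"
proof -
  have "hits A V Y S \<longleftrightarrow> hits B V Y S" for S
    using assms unfolding hits_def by blast
  then show ?thesis
    by (simp add: hitting_number_def)
qed

text \<open>Serves to undo the reordering of the edges, with a permutation as
  \<open>f\<close>.\<close>

lemma hitting_number_image: "hitting_number (\<lambda>j. A (f j)) V Y = hitting_number A V (f ` Y)"
  by (simp add: hitting_number_def hits_def)

subsection \<open>The dynamic program\<close>

abbreviation Var :: "string \<Rightarrow> aexp" where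
  "Var x \<equiv> Read x (Const 0)"

abbreviation Assign :: "string \<Rightarrow> aexp \<Rightarrow> com" (infix "::=" 61) where
  "x ::= a \<equiv> Write x (Const 0) a"

notation Seq (infixr ";;" 60)

abbreviation unchanged :: "string set \<Rightarrow> mem \<Rightarrow> mem \<Rightarrow> bool" where
  "unchanged W s s' \<equiv> \<forall>x. x \<notin> W \<longrightarrow> s' x = s x"

section \<open>Programs on bit masks and table cells\<close>

lemma diff_double_half [simp]: "r - (r div 2 + r div 2) = (if odd r then 1 else (0::nat))"
  by presburger

lemma div_double_pow2 [simp]: "x div (2 * 2 ^ i) = x div 2 ^ i div (2::nat)"
  by (metis div_mult2_eq mult.commute)

text \<open>\<open>r\<close> holds the unread bits of the mask \<open>x\<close>, and
  \<open>q\<close> is the weight of bit \<open>j\<close>. Subtracting twice its half from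
  \<open>r\<close> leaves the lowest bit. A bit is copied to \<open>z\<close> iff its edge avoids
  \<open>v\<close>.\<close>

definition reduce :: com where
  "reduce =
     ''z'' ::= Const 0 ;; ''r'' ::= Var ''x'' ;; ''q'' ::= Const 1 ;; ''j'' ::= Const 0 ;;
     While (Sub (Var ''c'') (Var ''j''))
       (Cond (Sub (Var ''r'') (Add (Half (Var ''r'')) (Half (Var ''r''))))
          (Cond (Read ''inc'' (Add (Read ''off'' (Var ''j'')) (Var ''v''))) Skip
             (''z'' ::= Add (Var ''z'') (Var ''q'')))
          Skip ;;
        ''r'' ::= Half (Var ''r'') ;;
        ''q'' ::= Add (Var ''q'') (Var ''q'') ;;
        ''j'' ::= Add (Var ''j'') (Const 1))"

lemma terminates_reduce:
  "terminates reduce s (5 + 7 * s ''c'' 0)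
     (\<lambda>s'. unchanged {''z'', ''r'', ''q'', ''j''} s s' \<and>
        s' ''z'' 0 = set_encode {l \<in> set_decode (s ''x'' 0).
          l < s ''c'' 0 \<and> s ''inc'' (s ''off'' l + s ''v'' 0) = 0})"
proof -
  define Z where "Z i = {l \<in> set_decode (s ''x'' 0).
          l < i \<and> s ''inc'' (s ''off'' l + s ''v'' 0) = 0}" for i
  have Z_Suc: "Z (Suc i) = (if odd (s ''x'' 0 div 2 ^ i) \<and> s ''inc'' (s ''off'' i + s ''v'' 0) = 0
      then insert i (Z i) else Z i)" for i
    by (auto simp: Z_def set_decode_def less_Suc_eq)
  have [simp]: "finite (Z i)" "i \<notin> Z i" for i
    by (auto simp: Z_def)
  define I where "I i s' \<longleftrightarrow> unchanged {''z'', ''r'', ''q'', ''j''} s s' \<and> s' ''j'' 0 = i \<and>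
     s' ''r'' 0 = s ''x'' 0 div 2 ^ i \<and> s' ''q'' 0 = 2 ^ i \<and> s' ''z'' 0 = set_encode (Z i)"
    for i and s' :: mem
  show ?thesis
    unfolding reduce_def Z_def[symmetric]
    apply simp
    apply (rule terminates_While[where I = I and lo = 0 and hi = "s ''c'' 0" and N = 6])
    subgoal by (simp add: I_def Z_def)
    subgoal by simp
    subgoal by (simp add: I_def)
    subgoal for i s'
      by (auto simp: I_def Z_Suc)
    subgoal by (simp add: I_def)
    subgoal by (simp add: I_def)
    subgoal by simp
    done
qed

text \<open>Any edge of the current set may be branched on. If the interval is nonempty it has to be
  its last edge, so that an interval remains; within the mask every bit is as good. \<open>e\<close>
  receives a row offset, not a position, and keeps a stale value if the set is empty.\<close>

definition pick_edge :: com where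
  "pick_edge =
     ''r'' ::= Var ''x'' ;; ''j'' ::= Const 0 ;;
     While (Sub (Var ''c'') (Var ''j''))
       (Cond (Sub (Var ''r'') (Add (Half (Var ''r'')) (Half (Var ''r''))))
          (''e'' ::= Read ''off'' (Var ''j'')) Skip ;;
        ''r'' ::= Half (Var ''r'') ;;
        ''j'' ::= Add (Var ''j'') (Const 1)) ;;
     Cond (Sub (Var ''i'') (Var ''c''))
       (''e'' ::= Read ''off'' (Sub (Var ''i'') (Const 1))) Skip"

lemma set_decode_less_pow2:
  assumes "x < 2 ^ c" and "l \<in> set_decode x"
  shows "l < c"
proof (rule ccontr)
  assume "\<not> l < c"
  then have "(2::nat) ^ c \<le> 2 ^ l"
    by (simp add: power_increasing)
  with assms show False
    by (simp add: set_decode_def)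
qed

lemma set_decode_eq_empty_iff [simp]: "set_decode x = {} \<longleftrightarrow> x = 0"
  using set_decode_inverse[of x] by (auto simp del: set_decode_inverse)

lemma terminates_pick_edge:
  assumes "s ''x'' 0 < 2 ^ s ''c'' 0"
  shows "terminates pick_edge s (5 + 5 * s ''c'' 0)
     (\<lambda>s'. unchanged {''r'', ''j'', ''e''} s s' \<and>
        (if s ''i'' 0 > s ''c'' 0 then s' ''e'' 0 = s ''off'' (s ''i'' 0 - 1)
         else s ''x'' 0 \<noteq> 0 \<longrightarrow> (\<exists>l\<in>set_decode (s ''x'' 0). s' ''e'' 0 = s ''off'' l)))"
proof -
  define I where "I i s' \<longleftrightarrow> unchanged {''r'', ''j'', ''e''} s s' \<and> s' ''j'' 0 = i \<and>
     s' ''r'' 0 = s ''x'' 0 div 2 ^ i \<and>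
     ((\<forall>l\<in>set_decode (s ''x'' 0). i \<le> l) \<or> (\<exists>l\<in>set_decode (s ''x'' 0). s' ''e'' 0 = s ''off'' l))"
    for i and s' :: mem
  have nonempty: "\<not> (\<forall>l\<in>set_decode (s ''x'' 0). s ''c'' 0 \<le> l)" if "s ''x'' 0 \<noteq> 0"
    using that set_decode_less_pow2[OF assms] by (metis set_decode_eq_empty_iff not_le equals0I)
  have dec: "i \<in> set_decode (s ''x'' 0) \<longleftrightarrow> odd (s ''x'' 0 div 2 ^ i)" for i
    by (simp add: set_decode_def)
  show ?thesis
    unfolding pick_edge_def
    apply simp
    apply (rule terminates_Seq[where ?N1.0 = "1 + 5 * s ''c'' 0" and ?N2.0 = 2])
     apply (rule terminates_While[where I = I and lo = 0 and hi = "s ''c'' 0" and N = 4])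
    subgoal by (simp add: I_def)
    subgoal by simp
    subgoal by (simp add: I_def)
    subgoal premises prems for i s'
    proof (cases "i \<in> set_decode (s ''x'' 0)")
      case True
      then have "odd (s ''x'' 0 div 2 ^ i)" "\<exists>l\<in>set_decode (s ''x'' 0). s ''off'' i = s ''off'' l"
        using dec by auto
      with prems show ?thesis
        by (simp add: I_def)
    next
      case False
      then have "even (s ''x'' 0 div 2 ^ i)"
        "(\<forall>l\<in>set_decode (s ''x'' 0). i \<le> l) \<longleftrightarrow> (\<forall>l\<in>set_decode (s ''x'' 0). Suc i \<le> l)"
        using dec by (auto simp: Suc_le_eq le_less)
      with prems show ?thesis
        by (simp add: I_def)
    qed
    subgoal by (simp add: I_def)
    subgoal for s'
      by (cases "s ''x'' 0 = 0") (simp_all add: I_def nonempty)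
    subgoal by simp
    subgoal by simp
    done
qed

definition best_vertex :: com where
  "best_vertex =
     ''v'' ::= Const 0 ;;
     While (Sub (Var ''n'') (Var ''v''))
       (Cond (Read ''inc'' (Add (Var ''e'') (Var ''v'')))
          (reduce ;;
           Cond (Sub (Var ''best'') (Add (Read ''F'' (Add (Var ''prev'') (Var ''z''))) (Const 1)))
             (''best'' ::= Add (Read ''F'' (Add (Var ''prev'') (Var ''z''))) (Const 1)) Skip)
          Skip ;;
        ''v'' ::= Add (Var ''v'') (Const 1))"

text \<open>The three conjuncts on \<open>best\<close> say that it is the minimum of its initial
  value and all \<open>val u\<close> for vertices \<open>u\<close> of the chosen edge, without
  forming that set.\<close>

lemma terminates_best_vertex:
  fixes s :: mem
  defines "val u \<equiv> Suc (s ''F'' (s ''prev'' 0 + set_encode {l \<in> set_decode (s ''x'' 0).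
          l < s ''c'' 0 \<and> s ''inc'' (s ''off'' l + u) = 0}))"
  shows "terminates best_vertex s (2 + s ''n'' 0 * (10 + 7 * s ''c'' 0))
     (\<lambda>s'. unchanged {''z'', ''r'', ''q'', ''j'', ''v'', ''best''} s s' \<and>
        s' ''best'' 0 \<le> s ''best'' 0 \<and>
        (\<forall>u < s ''n'' 0. s ''inc'' (s ''e'' 0 + u) \<noteq> 0 \<longrightarrow> s' ''best'' 0 \<le> val u) \<and>
        (s' ''best'' 0 = s ''best'' 0 \<or>
          (\<exists>u < s ''n'' 0. s ''inc'' (s ''e'' 0 + u) \<noteq> 0 \<and> s' ''best'' 0 = val u)))"
proof -
  define I where "I i s' \<longleftrightarrow> unchanged {''z'', ''r'', ''q'', ''j'', ''v'', ''best''} s s' \<and>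
        s' ''v'' 0 = i \<and> s' ''best'' 0 \<le> s ''best'' 0 \<and>
        (\<forall>u < i. s ''inc'' (s ''e'' 0 + u) \<noteq> 0 \<longrightarrow> s' ''best'' 0 \<le> val u) \<and>
        (s' ''best'' 0 = s ''best'' 0 \<or>
          (\<exists>u < i. s ''inc'' (s ''e'' 0 + u) \<noteq> 0 \<and> s' ''best'' 0 = val u))"
    for i and s' :: mem
  show ?thesis
    unfolding best_vertex_def
    apply simp
    apply (rule terminates_While[where I = I and lo = 0 and hi = "s ''n'' 0" and N = "9 + 7 * s ''c'' 0"])
    subgoal by (simp add: I_def)
    subgoal by simp
    subgoal by (simp add: I_def)
    subgoal for i s'
      apply simp
      apply (intro conjI impI)
      subgoal
        apply (rule terminates_Seq[where ?N1.0 = "5 + 7 * s ''c'' 0" and ?N2.0 = 3])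
        apply (rule terminates_mono[OF terminates_reduce])
        subgoal premises prems for s''
        proof -
          have I: "I i s'" by (rule prems)
          have u: "unchanged {''z'', ''r'', ''q'', ''j''} s' s''"
            using prems by blast
          have u': "unchanged {''z'', ''r'', ''q'', ''j'', ''v'', ''best''} s s''"
            using I u by (simp add: I_def)
          have z: "s'' ''F'' (s'' ''prev'' 0 + s'' ''z'' 0) + 1 = val i"
            using prems by (simp add: I_def val_def)
          have b: "s'' ''best'' 0 = s' ''best'' 0" "s'' ''v'' 0 = i" "s ''inc'' (s ''e'' 0 + i) \<noteq> 0"
            using prems by (simp_all add: I_def)
          have "I (Suc i) (s''(''best'' := (s'' ''best'')(0 := b), ''v'' := (s'' ''v'')(0 := Suc i)))"
            if "b = min (s' ''best'' 0) (val i)" for b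
          proof -
            have 1: "\<forall>u<i. s ''inc'' (s ''e'' 0 + u) \<noteq> 0 \<longrightarrow> s' ''best'' 0 \<le> val u"
              and 2: "s' ''best'' 0 = s ''best'' 0 \<or>
                (\<exists>u<i. s ''inc'' (s ''e'' 0 + u) \<noteq> 0 \<and> s' ''best'' 0 = val u)"
              and 3: "s' ''best'' 0 \<le> s ''best'' 0"
              using I by (simp_all add: I_def)
            have 4: "\<forall>u<Suc i. s ''inc'' (s ''e'' 0 + u) \<noteq> 0 \<longrightarrow> b \<le> val u"
              unfolding All_less_Suc that using 1 by (metis min.cobounded2 min.coboundedI1)
            have "b = s' ''best'' 0 \<or> b = val i"
              using that by (simp add: min_def)
            then have 5: "b = s ''best'' 0 \<or> (\<exists>u<Suc i. s ''inc'' (s ''e'' 0 + u) \<noteq> 0 \<and> b = val u)"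
              unfolding Ex_less_Suc using 2 b(3) by metis
            show ?thesis
              unfolding I_def using u' 4 5 3 that by simp
          qed
          \<comment> \<open>If the test fails nothing is stored; \<open>fun_upd_idem\<close>
            identifies this with writing back the old minimum.\<close>
          from this[OF refl] show ?thesis
            using z b by (auto simp: min_def fun_upd_idem not_less)
        qed
        subgoal by (simp add: I_def)
        subgoal by simp
        done
      subgoal by (auto simp: I_def less_Suc_eq)
      done
    subgoal by (simp add: I_def)
    subgoal by (simp add: I_def)
    subgoal by simp
    done
qed

text \<open>\<open>m + 1\<close> plays the role of infinity, as no hitting number exceeds
  \<open>m\<close>. For the empty set \<open>best\<close> starts at 0, which the search can only
  lower, so the stale \<open>e\<close> does no harm.\<close>

definition fill_cell :: com where
  "fill_cell =
     pick_edge ;;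
     Cond (Add (Var ''x'') (Sub (Var ''i'') (Var ''c'')))
       (''best'' ::= Add (Var ''m'') (Const 1)) (''best'' ::= Const 0) ;;
     best_vertex ;;
     Write ''F'' (Add (Var ''base'') (Var ''x'')) (Var ''best'') ;;
     ''x'' ::= Add (Var ''x'') (Const 1)"

definition fill_row :: com where
  "fill_row =
     ''x'' ::= Const 0 ;;
     While (Sub (Var ''P'') (Var ''x'')) fill_cell ;;
     ''prev'' ::= Var ''base'' ;;
     ''base'' ::= Add (Var ''base'') (Var ''P'') ;;
     ''i'' ::= Add (Var ''i'') (Const 1)"

text \<open>Row \<open>c\<close> has no predecessor; starting with \<open>prev\<close> equal to
  \<open>base\<close> makes it refer to itself. This is sound because masks are treated in
  increasing order and there the chosen vertex always clears a bit.\<close>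

definition fill_table :: com where
  "fill_table =
     ''i'' ::= Var ''c'' ;; ''base'' ::= Const 0 ;; ''prev'' ::= Const 0 ;;
     While (Sub (Add (Var ''m'') (Const 1)) (Var ''i'')) fill_row"

definition power_of_two :: com where
  "power_of_two =
     ''P'' ::= Const 1 ;; ''j'' ::= Const 0 ;;
     While (Sub (Var ''c'') (Var ''j''))
       (''P'' ::= Add (Var ''P'') (Var ''P'') ;; ''j'' ::= Add (Var ''j'') (Const 1))"

text \<open>After the last row \<open>prev\<close> points to it, and its full mask
  \<open>P - 1\<close> stands for all edges. By truncation the test succeeds iff the hitting number
  plus \<open>k\<close> is at most \<open>m\<close>.\<close>

definition dynamic_program :: com where
  "dynamic_program =
     power_of_two ;; fill_table ;;
     Cond (Sub (Add (Var ''m'') (Const 1))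
             (Add (Read ''F'' (Add (Var ''prev'') (Sub (Var ''P'') (Const 1)))) (Var ''k'')))
       (''out'' ::= Const 1) (''out'' ::= Const 0)"

lemma terminates_power_of_two:
  "terminates power_of_two s (3 + 3 * s ''c'' 0)
     (\<lambda>s'. unchanged {''P'', ''j''} s s' \<and> s' ''P'' 0 = 2 ^ s ''c'' 0)"
proof -
  define I where "I i s' \<longleftrightarrow> unchanged {''P'', ''j''} s s' \<and> s' ''j'' 0 = i \<and> s' ''P'' 0 = 2 ^ i"
    for i and s' :: mem
  show ?thesis
    unfolding power_of_two_def
    apply simp
    apply (rule terminates_While[where I = I and lo = 0 and hi = "s ''c'' 0" and N = 2])
    subgoal by (simp add: I_def)
    subgoal by simp
    subgoal by (simp add: I_def)
    subgoal by (simp add: I_def)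
    subgoal by (simp add: I_def)
    subgoal by (simp add: I_def)
    subgoal by simp
    done
qed

section \<open>Correctness of the recurrence and of the table\<close>

lemma set_decode_pow2_minus_1: "set_decode (2 ^ c - 1) = {..<c}"
proof -
  have "set_encode {..<c} = 2 ^ c - 1"
    using sum_power2[of c] by (simp add: set_encode_def lessThan_atLeast0)
  then show ?thesis
    by (metis set_encode_inverse finite_lessThan)
qed

text \<open>The situation after the greedy pass: positions below \<open>c\<close> carry the edges
  already hit, and by \<open>unique\<close> the edges from position \<open>c\<close> on are pairwise
  disjoint. \<open>off\<close> translates positions to matrix rows.\<close>

locale partitioned_incidence =
  fixes n m c :: nat and inc off :: "nat \<Rightarrow> nat"
  assumes c_le_m: "c \<le> m"
    and coverable: "j < m \<Longrightarrow> \<exists>v<n. inc (off j + v) \<noteq> 0"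
    and unique: "v < n \<Longrightarrow> c \<le> i \<Longrightarrow> i < m \<Longrightarrow> c \<le> j \<Longrightarrow> j < m \<Longrightarrow>
      inc (off i + v) \<noteq> 0 \<Longrightarrow> inc (off j + v) \<noteq> 0 \<Longrightarrow> i = j"
begin

abbreviation adj :: "nat \<Rightarrow> nat \<Rightarrow> bool" where
  "adj j v \<equiv> inc (off j + v) \<noteq> 0"

abbreviation tau :: "nat set \<Rightarrow> nat" where
  "tau \<equiv> hitting_number adj {..<n}"

definition edges :: "nat \<Rightarrow> nat \<Rightarrow> nat set" where
  "edges i X = set_decode X \<union> {c..<i}"

definition rest :: "nat \<Rightarrow> nat \<Rightarrow> nat" where
  "rest X u = set_encode {l \<in> set_decode X. l < c \<and> inc (off l + u) = 0}"

definition env :: "mem \<Rightarrow> bool" where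
  "env s \<longleftrightarrow> s ''n'' 0 = n \<and> s ''m'' 0 = m \<and> s ''c'' 0 = c \<and> s ''inc'' = inc \<and>
     s ''off'' = off \<and> s ''P'' 0 = 2 ^ c"

lemma set_decode_rest: "set_decode (rest X u) = {l \<in> set_decode X. l < c \<and> \<not> adj l u}"
  by (simp add: rest_def)

lemma rest_le: "rest X u \<le> X"
  by (rule subset_decode_imp_le) (auto simp: set_decode_rest)

text \<open>The order argument that allows row \<open>c\<close> to be filled from itself: a proper
  subset has a smaller code.\<close>

lemma rest_less:
  assumes "j \<in> set_decode X" and "adj j u"
  shows "rest X u < X"
  using rest_le[of X u] assms set_decode_rest[of X u] by (metis (mono_tags, lifting) le_neq_implies_less mem_Collect_eq)

lemma edges_subset:
  assumes "X < 2 ^ c" and "i \<le> m"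
  shows "edges i X \<subseteq> {..<m}"
  using set_decode_less_pow2[OF assms(1)] assms(2) c_le_m by (fastforce simp: edges_def)

text \<open>States are closed under the recurrence: by \<open>unique\<close>, a vertex of edge
  \<open>i - 1\<close> hits no other edge of the interval, which thus only loses its end. For
  \<open>i = c\<close> the interval is empty before and after.\<close>

lemma edges_removed:
  assumes "X < 2 ^ c" and "c \<le> i" and "i \<le> m" and "u < n" and "adj j u"
    and "if c < i then j = i - 1 else j \<in> set_decode X"
  shows "{l \<in> edges i X. \<not> adj l u} = edges (i - 1) (rest X u)"
proof -
  have "{l \<in> set_decode X. \<not> adj l u} = set_decode (rest X u)"
    using set_decode_less_pow2[OF assms(1)] by (auto simp: set_decode_rest)
  moreover have "{l \<in> {c..<i}. \<not> adj l u} = {c..<i - 1}"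
  proof (cases "c < i")
    case True
    then have j: "j = i - 1" "c \<le> j" "j < m"
      using assms by auto
    have "\<not> adj l u" if "l \<in> {c..<i - 1}" for l
      using unique[of u l j] that assms j by auto
    moreover have "{c..<i} = insert j {c..<i - 1}"
      using True j by auto
    ultimately show ?thesis
      using assms(5) by auto
  qed (use assms in auto)
  ultimately show ?thesis
    unfolding edges_def by blast
qed

text \<open>\<open>b\<close> is the outcome of \<open>best_vertex\<close>: no larger than any
  candidate, and itself a candidate or the default \<open>m + 1\<close>. The recurrence supplies an
  optimal candidate of value at most \<open>m\<close>, which the default cannot undercut.\<close>

lemma tau_edges_eqI:
  assumes "X < 2 ^ c" and "c \<le> i" and "i \<le> m" and "j \<in> edges i X"
    and "if c < i then j = i - 1 else j \<in> set_decode X"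
    and upper: "\<And>u. u < n \<Longrightarrow> adj j u \<Longrightarrow> b \<le> Suc (tau (edges (i - 1) (rest X u)))"
    and attained: "b = m + 1 \<or> (\<exists>u<n. adj j u \<and> b = Suc (tau (edges (i - 1) (rest X u))))"
  shows "b = tau (edges i X)"
proof -
  have fin: "finite (edges i X)"
    by (simp add: edges_def)
  have cov: "\<exists>v\<in>{..<n}. adj l v" if "l \<in> edges i X" for l
    using coverable edges_subset[OF assms(1,3)] that by auto
  have "tau (edges i X) \<le> card (edges i X)"
    using fin cov by (rule hitting_number_le_card)
  also have "\<dots> \<le> m"
    using card_mono[OF _ edges_subset[OF assms(1,3)]] by simp
  finally have le_m: "tau (edges i X) \<le> m" .
  obtain v where v: "v \<in> {..<n}" "adj j v" "tau (edges i X) = 1 + tau {l \<in> edges i X. \<not> adj l v}"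
    by (rule hitting_number_step_attained[OF _ cov assms(4)]) auto
  then have le: "b \<le> tau (edges i X)"
    using upper[of v] edges_removed[OF assms(1,2,3) _ v(2) assms(5)] by simp
  have ge: "tau (edges i X) \<le> b" if u: "u < n" "adj j u" "b = Suc (tau (edges (i - 1) (rest X u)))" for u
  proof -
    have "tau (edges i X) \<le> 1 + tau {l \<in> edges i X. \<not> adj l u}"
      by (rule hitting_number_step_le) (use cov u in auto)
    then show ?thesis
      using u edges_removed[OF assms(1,2,3) u(1,2) assms(5)] by simp
  qed
  from attained show ?thesis
  proof
    \<comment> \<open>Impossible, since \<open>b\<close> is at most the hitting number and this is
      at most \<open>m\<close>.\<close>
    assume "b = m + 1"
    with le le_m show ?thesis by simp
  next
    assume "\<exists>u<n. adj j u \<and> b = Suc (tau (edges (i - 1) (rest X u)))"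
    with ge le show ?thesis
      by (intro antisym) blast+
  qed
qed

text \<open>Truncated subtraction makes \<open>prev\<close> and \<open>base\<close> coincide for
  \<open>i = c\<close>, so both kinds of rows share one statement.\<close>

lemma terminates_fill_cell:
  fixes s :: mem
  defines "i \<equiv> s ''i'' 0" and "X \<equiv> s ''x'' 0"
  assumes "env s" and X: "X < 2 ^ c" and i: "c \<le> i" "i \<le> m"
    and prev: "s ''prev'' 0 = (i - c - 1) * 2 ^ c" and base: "s ''base'' 0 = (i - c) * 2 ^ c"
    and prev_row: "c < i \<Longrightarrow> \<forall>Y < 2 ^ c. s ''F'' (s ''prev'' 0 + Y) = tau (edges (i - 1) Y)"
    and this_row: "\<forall>Y < X. s ''F'' (s ''base'' 0 + Y) = tau (edges i Y)"
  shows "terminates fill_cell s (11 + 5 * c + n * (10 + 7 * c))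
     (\<lambda>s'. unchanged {''z'', ''r'', ''q'', ''j'', ''v'', ''e'', ''best'', ''F'', ''x''} s s' \<and>
        s' ''x'' 0 = Suc X \<and> s' ''F'' = (s ''F'')(s ''base'' 0 + X := tau (edges i X)))"
proof -
  have s: "s ''n'' 0 = n" "s ''m'' 0 = m" "s ''c'' 0 = c" "s ''inc'' = inc" "s ''off'' = off"
    using \<open>env s\<close> by (simp_all add: env_def)
  define b0 where "b0 = (if X + (i - c) = 0 then 0 else m + 1)"
  \<comment> \<open>The entry looked up is in the previous row if \<open>c < i\<close>, and
    otherwise in the part of the same row that is already filled.\<close>
  have entry: "s ''F'' (s ''prev'' 0 + rest X u) = tau (edges (i - 1) (rest X u))"
    if "adj j u" and j: "if c < i then j = i - 1 else j \<in> set_decode X" for j u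
  proof (cases "c < i")
    case True
    then show ?thesis
      using prev_row order.strict_trans1[OF rest_le X] by blast
  next
    case False
    then have "rest X u < X" "i = c"
      using that i rest_less by auto
    then show ?thesis
      using this_row prev base by (simp add: edges_def)
  qed
  have final: "b = tau (edges i X)"
    if e: "if c < i then e = off (i - 1) else X \<noteq> 0 \<longrightarrow> (\<exists>l\<in>set_decode X. e = off l)"
      and b: "b \<le> b0"
      "\<forall>u<n. inc (e + u) \<noteq> 0 \<longrightarrow> b \<le> Suc (s ''F'' (s ''prev'' 0 + rest X u))"
      "b = b0 \<or> (\<exists>u<n. inc (e + u) \<noteq> 0 \<and> b = Suc (s ''F'' (s ''prev'' 0 + rest X u)))"
    for e b
  proof (cases "X + (i - c) = 0")
    case True
    then have "X = 0" "i = c" "b = 0"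
      using b(1) i by (simp_all add: b0_def)
    then show ?thesis
      by (simp add: edges_def)
  next
    case False
    obtain j where j: "if c < i then j = i - 1 else j \<in> set_decode X" "e = off j"
      using e False i by (cases "c < i") auto
    show ?thesis
    proof (rule tau_edges_eqI[OF X i _ j(1)])
      show "j \<in> edges i X"
        using j(1) i by (auto simp: edges_def split: if_splits)
      show "b \<le> Suc (tau (edges (i - 1) (rest X u)))" if "u < n" "adj j u" for u
        using that b(2) entry[OF that(2) j(1)] j(2) by auto
      show "b = m + 1 \<or> (\<exists>u<n. adj j u \<and> b = Suc (tau (edges (i - 1) (rest X u))))"
        using b(3) entry[OF _ j(1)] j(2) False by (auto simp: b0_def)
    qed
  qed
  show ?thesis
    unfolding fill_cell_def
    apply (rule terminates_Seq[where ?N1.0 = "5 + 5 * c" and ?N2.0 = "6 + n * (10 + 7 * c)"])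
     apply (rule terminates_mono[OF terminates_pick_edge])
    subgoal using X by (simp add: s X_def)
    subgoal premises prems for s1
    proof -
      \<comment> \<open>Both branches of the initialization of \<open>best\<close> lead to this
        memory.\<close>
      define s2 where "s2 = s1(''best'' := (s1 ''best'')(0 := b0))"
      have u1: "unchanged {''r'', ''j'', ''e''} s s1"
        using prems by blast
      have e: "if c < i then s1 ''e'' 0 = off (i - 1) else X \<noteq> 0 \<longrightarrow> (\<exists>l\<in>set_decode X. s1 ''e'' 0 = off l)"
        using prems by (cases "c < i") (simp_all add: s i_def[symmetric] X_def[symmetric])
      have s2: "s2 ''n'' 0 = n" "s2 ''c'' 0 = c" "s2 ''inc'' = inc" "s2 ''off'' = off" "s2 ''x'' 0 = X"
        "s2 ''F'' = s ''F''" "s2 ''prev'' 0 = s ''prev'' 0" "s2 ''e'' 0 = s1 ''e'' 0" "s2 ''best'' 0 = b0"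
        using u1 by (simp_all add: s2_def s X_def)
      have "terminates (best_vertex ;;
        Write ''F'' (Add (Var ''base'') (Var ''x'')) (Var ''best'') ;;
        ''x'' ::= Add (Var ''x'') (Const 1)) s2 (4 + n * (10 + 7 * c))
       (\<lambda>s'. unchanged {''z'', ''r'', ''q'', ''j'', ''v'', ''e'', ''best'', ''F'', ''x''} s s' \<and>
        s' ''x'' 0 = Suc X \<and> s' ''F'' = (s ''F'')(s ''base'' 0 + X := tau (edges i X)))"
        apply (rule terminates_Seq[where ?N1.0 = "2 + n * (10 + 7 * c)" and ?N2.0 = 2])
         apply (rule terminates_mono[OF terminates_best_vertex])
        subgoal premises prems for s3
        proof -
          have u3: "unchanged {''z'', ''r'', ''q'', ''j'', ''v'', ''best''} s2 s3"
            using prems by blast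
          have b: "s3 ''best'' 0 = tau (edges i X)"
            using prems by (intro final[OF e]; unfold s2 rest_def) blast+
          show ?thesis
            using u1 u3 b by (simp add: s2_def X_def)
        qed
        subgoal using u1 by (simp add: s2_def s)
        subgoal by simp
        done
      moreover have "aval (Add (Var ''x'') (Sub (Var ''i'') (Var ''c''))) s1 = X + (i - c)"
        "aval (Add (Var ''m'') (Const 1)) s1 = m + 1"
        using u1 by (simp_all add: s X_def i_def)
      moreover define y where "y = X + (i - c)"
      ultimately show ?thesis
        unfolding s2_def b0_def terminates_Seq_Cond terminates_Seq_Write y_def[symmetric]
        by (cases "y = 0") simp_all
    qed
    subgoal by (simp add: s)
    subgoal by simp
    done
qed

lemma terminates_fill_row:
  fixes s :: mem
  defines "i \<equiv> s ''i'' 0"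
  assumes "env s" and i: "c \<le> i" "i \<le> m"
    and prev: "s ''prev'' 0 = (i - c - 1) * 2 ^ c" and base: "s ''base'' 0 = (i - c) * 2 ^ c"
    and prev_row: "c < i \<Longrightarrow> \<forall>Y < 2 ^ c. s ''F'' (s ''prev'' 0 + Y) = tau (edges (i - 1) Y)"
  shows "terminates fill_row s (5 + 2 ^ c * (12 + 5 * c + n * (10 + 7 * c)))
     (\<lambda>s'. unchanged {''z'', ''r'', ''q'', ''j'', ''v'', ''e'', ''best'', ''F'', ''x'', ''i'', ''prev'', ''base''} s s' \<and>
        s' ''i'' 0 = Suc i \<and> s' ''prev'' 0 = (i - c) * 2 ^ c \<and> s' ''base'' 0 = (Suc i - c) * 2 ^ c \<and>
        (\<forall>Y < 2 ^ c. s' ''F'' ((i - c) * 2 ^ c + Y) = tau (edges i Y)))"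
proof -
  define I where "I X s' \<longleftrightarrow>
    unchanged {''z'', ''r'', ''q'', ''j'', ''v'', ''e'', ''best'', ''F'', ''x''} s s' \<and> s' ''x'' 0 = X \<and>
    (c < i \<longrightarrow> (\<forall>Y < 2 ^ c. s' ''F'' (s ''prev'' 0 + Y) = tau (edges (i - 1) Y))) \<and>
    (\<forall>Y < X. s' ''F'' (s ''base'' 0 + Y) = tau (edges i Y))" for X and s' :: mem
  have env: "env s'" if "I X s'" for X s'
    using that \<open>env s\<close> by (simp add: I_def env_def)
  have I_D: "s' ''P'' 0 = 2 ^ c" "s' ''x'' 0 = X" if "I X s'" for X s'
    using env[OF that] that by (simp_all add: I_def env_def)
  \<comment> \<open>Rows are consecutive blocks of \<open>2 ^ c\<close> cells, so writing row
    \<open>i\<close> preserves the row below, which is still being read.\<close>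
  have disjoint: "s ''prev'' 0 + Y < s ''base'' 0" if "c < i" "Y < 2 ^ c" for Y
  proof -
    have "s ''base'' 0 = s ''prev'' 0 + 2 ^ c"
      using that(1) unfolding prev base
      by (metis Suc_diff_1 add.commute mult_Suc zero_less_diff)
    then show ?thesis using that(2) by simp
  qed
  show ?thesis
    unfolding fill_row_def
    apply simp
    apply (rule terminates_Seq[where ?N1.0 = "1 + 2 ^ c * (12 + 5 * c + n * (10 + 7 * c))" and ?N2.0 = 3])
     apply (rule terminates_While[where I = I and lo = 0 and hi = "2 ^ c" and N = "11 + 5 * c + n * (10 + 7 * c)"])
    subgoal using prev_row by (simp add: I_def)
    subgoal by simp
    subgoal by (simp add: I_D)
    subgoal premises prems for X s'
    proof -
      have u: "unchanged {''z'', ''r'', ''q'', ''j'', ''v'', ''e'', ''best'', ''F'', ''x''} s s'"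
        and x: "s' ''x'' 0 = X"
        and p: "c < i \<Longrightarrow> \<forall>Y < 2 ^ c. s' ''F'' (s ''prev'' 0 + Y) = tau (edges (i - 1) Y)"
        and t: "\<forall>Y < X. s' ''F'' (s ''base'' 0 + Y) = tau (edges i Y)"
        using prems(3) by (simp_all add: I_def)
      have eqs: "s' ''i'' 0 = i" "s' ''prev'' 0 = s ''prev'' 0" "s' ''base'' 0 = s ''base'' 0"
        using u by (simp_all add: i_def)
      show ?thesis
        apply (rule terminates_mono[OF terminates_fill_cell])
        subgoal using env prems(3) by blast
        subgoal using prems x by simp
        subgoal using i eqs by simp
        subgoal using i eqs by simp
        subgoal using prev eqs by simp
        subgoal using base eqs by simp
        subgoal using p eqs by simp
        subgoal using t eqs x by simp
        subgoal premises prems' for s''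
        proof -
          have u': "unchanged {''z'', ''r'', ''q'', ''j'', ''v'', ''e'', ''best'', ''F'', ''x''} s s''"
            using u prems' by simp
          have F: "s'' ''F'' = (s' ''F'')(s ''base'' 0 + X := tau (edges i X))" "s'' ''x'' 0 = Suc X"
            using prems' eqs x by simp_all
          have "\<forall>Y < 2 ^ c. s'' ''F'' (s ''prev'' 0 + Y) = tau (edges (i - 1) Y)" if "c < i"
          proof (intro allI impI)
            fix Y :: nat assume "Y < 2 ^ c"
            then show "s'' ''F'' (s ''prev'' 0 + Y) = tau (edges (i - 1) Y)"
              using p[OF that] disjoint[OF that, of Y] by (simp add: F)
          qed
          moreover have "\<forall>Y < Suc X. s'' ''F'' (s ''base'' 0 + Y) = tau (edges i Y)"
            using t unfolding F All_less_Suc by simp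
          ultimately show ?thesis
            unfolding I_def using u' F(2) by blast
        qed
        subgoal by simp
        done
    qed
    subgoal by (simp add: I_D)
    subgoal premises prems for s'
    proof -
      have u: "unchanged {''z'', ''r'', ''q'', ''j'', ''v'', ''e'', ''best'', ''F'', ''x''} s s'"
        and t: "\<forall>Y < 2 ^ c. s' ''F'' (s ''base'' 0 + Y) = tau (edges i Y)"
        using prems by (simp_all add: I_def)
      have eqs: "s' ''i'' 0 = i" "s' ''base'' 0 = s ''base'' 0" "s' ''P'' 0 = 2 ^ c"
        using u env[OF prems] by (simp_all add: i_def env_def)
      have "s ''i'' 0 = i" "s ''P'' 0 = 2 ^ c"
        using \<open>env s\<close> by (simp_all add: i_def env_def)
      then show ?thesis
        using u t i by (simp add: eqs base Suc_diff_le)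
    qed
    subgoal by simp
    subgoal by simp
    done
qed

lemma terminates_fill_table:
  assumes "env s"
  shows "terminates fill_table s (4 + (m + 1) * (6 + 2 ^ c * (12 + 5 * c + n * (10 + 7 * c))))
     (\<lambda>s'. s' ''m'' 0 = m \<and> s' ''k'' 0 = s ''k'' 0 \<and> s' ''P'' 0 = 2 ^ c \<and>
        s' ''F'' (s' ''prev'' 0 + (2 ^ c - 1)) = tau {..<m})"
proof -
  \<comment> \<open>At index \<open>i\<close> the invariant describes row \<open>i - 1\<close>, the
    last one completed. So the loop has to run up to \<open>m + 1\<close> to deliver row
    \<open>m\<close>.\<close>
  define I where "I i s' \<longleftrightarrow>
    unchanged {''z'', ''r'', ''q'', ''j'', ''v'', ''e'', ''best'', ''F'', ''x'', ''i'', ''prev'', ''base''} s s' \<and>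
    s' ''i'' 0 = i \<and> s' ''prev'' 0 = (i - c - 1) * 2 ^ c \<and> s' ''base'' 0 = (i - c) * 2 ^ c \<and>
    (c < i \<longrightarrow> (\<forall>Y < 2 ^ c. s' ''F'' ((i - c - 1) * 2 ^ c + Y) = tau (edges (i - 1) Y)))" for i and s' :: mem
  have env: "env s'" if "I i s'" for i s'
    using that assms by (simp add: I_def env_def)
  have I_D: "s' ''m'' 0 = m" "s' ''P'' 0 = 2 ^ c" "s' ''i'' 0 = i" if "I i s'" for i s'
    using env[OF that] that by (simp_all add: I_def env_def)
  have all: "edges m (2 ^ c - 1) = {..<m}"
    using c_le_m by (auto simp: edges_def set_decode_pow2_minus_1[simplified])
  show ?thesis
    unfolding fill_table_def
    apply simp
    apply (rule terminates_While[where I = I and lo = c and hi = "m + 1" and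
        N = "5 + 2 ^ c * (12 + 5 * c + n * (10 + 7 * c))"])
    subgoal using assms by (simp add: I_def env_def)
    subgoal using c_le_m by simp
    subgoal by (simp add: I_D)
    subgoal premises prems for i s'
    proof -
      have u: "unchanged {''z'', ''r'', ''q'', ''j'', ''v'', ''e'', ''best'', ''F'', ''x'', ''i'', ''prev'', ''base''} s s'"
        and eqs: "s' ''i'' 0 = i" "s' ''prev'' 0 = (i - c - 1) * 2 ^ c" "s' ''base'' 0 = (i - c) * 2 ^ c"
        using prems(3) by (simp_all add: I_def)
      have p: "\<forall>Y < 2 ^ c. s' ''F'' ((i - c - 1) * 2 ^ c + Y) = tau (edges (i - 1) Y)" if "c < i"
        using prems(3) that unfolding I_def by (elim conjE) (erule mp)
      show ?thesis
        apply (rule terminates_mono[OF terminates_fill_row])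
        subgoal using env prems(3) by blast
        subgoal using prems eqs by simp
        subgoal using prems eqs by simp
        subgoal using eqs by simp
        subgoal using eqs by simp
        subgoal using p eqs by simp
        subgoal for s'' unfolding I_def using u eqs by simp
        subgoal by simp
        done
    qed
    subgoal by (simp add: I_D)
    subgoal premises prems for s'
    proof -
      have row: "\<forall>Y < 2 ^ c. s' ''F'' ((m - c) * 2 ^ c + Y) = tau (edges m Y)"
        and eqs: "s' ''prev'' 0 = (m - c) * 2 ^ c" "s' ''k'' 0 = s ''k'' 0"
        using prems c_le_m by (simp_all add: I_def)
      have "(2::nat) ^ c - 1 < 2 ^ c"
        by simp
      with row have "s' ''F'' (s' ''prev'' 0 + (2 ^ c - 1)) = tau {..<m}"
        unfolding eqs all[symmetric] by blast
      then show ?thesis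
        using I_D[OF prems] eqs by simp
    qed
    subgoal
      using mult_le_mono1[of "m + 1 - c" "m + 1" "6 + 2 ^ c * (12 + 5 * c + n * (10 + 7 * c))"]
      by simp
    done
qed

lemma terminates_dynamic_program:
  assumes "s ''n'' 0 = n" "s ''m'' 0 = m" "s ''c'' 0 = c" "s ''inc'' = inc" "s ''off'' = off"
  shows "terminates dynamic_program s
     (9 + 3 * c + (m + 1) * (6 + 2 ^ c * (12 + 5 * c + n * (10 + 7 * c))))
     (\<lambda>s'. s' ''out'' 0 = (if tau {..<m} + s ''k'' 0 \<le> m then 1 else 0))"
  unfolding dynamic_program_def
  apply (rule terminates_Seq[where ?N1.0 = "3 + 3 * c" and
        ?N2.0 = "6 + (m + 1) * (6 + 2 ^ c * (12 + 5 * c + n * (10 + 7 * c)))"])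
   apply (rule terminates_mono[OF terminates_power_of_two])
  subgoal for s'
    apply (rule terminates_Seq[where ?N1.0 = "4 + (m + 1) * (6 + 2 ^ c * (12 + 5 * c + n * (10 + 7 * c)))" and ?N2.0 = 2])
     apply (rule terminates_mono[OF terminates_fill_table])
    subgoal using assms by (simp add: env_def)
    subgoal for s'' by simp
    subgoal by simp
    subgoal by simp
    done
  subgoal using assms by simp
  subgoal by simp
  done

end

subsection \<open>The greedy pass\<close>

text \<open>A partition as in quicksort: positions from \<open>c\<close> to below \<open>d\<close>
  hold the inspected edges that contain \<open>v\<close>. Only row offsets are swapped, and the
  matrix stays fixed.\<close>

definition partition_by_vertex :: com where
  "partition_by_vertex =
     ''d'' ::= Var ''c'' ;; ''j'' ::= Var ''c'' ;;
     While (Sub (Var ''m'') (Var ''j''))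
       (Cond (Read ''inc'' (Add (Read ''off'' (Var ''j'')) (Var ''v'')))
          (''t'' ::= Read ''off'' (Var ''j'') ;;
           Write ''off'' (Var ''j'') (Read ''off'' (Var ''d'')) ;;
           Write ''off'' (Var ''d'') (Var ''t'') ;;
           ''d'' ::= Add (Var ''d'') (Const 1))
          Skip ;;
        ''j'' ::= Add (Var ''j'') (Const 1))"

text \<open>By truncation the test means \<open>d \<ge> c + 2\<close>, that is, at least two newly
  hit edges. Then moving \<open>c\<close> to \<open>d\<close> freezes their block; otherwise the
  pass has merely permuted the unhit edges.\<close>

definition greedy :: com where
  "greedy =
     ''c'' ::= Const 0 ;; ''v'' ::= Const 0 ;;
     While (Sub (Var ''n'') (Var ''v''))
       (partition_by_vertex ;;
        Cond (Sub (Var ''d'') (Add (Var ''c'') (Const 1))) (''c'' ::= Var ''d'') Skip ;;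
        ''v'' ::= Add (Var ''v'') (Const 1))"

text \<open>Multiples of \<open>n\<close> are accumulated, as the machine cannot multiply.\<close>

definition row_offsets :: com where
  "row_offsets =
     ''j'' ::= Const 0 ;; ''p'' ::= Const 0 ;;
     While (Sub (Var ''m'') (Var ''j''))
       (Write ''off'' (Var ''j'') (Var ''p'') ;;
        ''p'' ::= Add (Var ''p'') (Var ''n'') ;;
        ''j'' ::= Add (Var ''j'') (Const 1))"

section \<open>Correctness of the greedy pass\<close>

lemma terminates_row_offsets:
  "terminates row_offsets s (3 + 4 * s ''m'' 0)
     (\<lambda>s'. unchanged {''off'', ''p'', ''j''} s s' \<and>
        (\<forall>j < s ''m'' 0. s' ''off'' j = j * s ''n'' 0))"
proof -
  define I where "I i s' \<longleftrightarrow> unchanged {''off'', ''p'', ''j''} s s' \<and> s' ''j'' 0 = i \<and>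
      s' ''p'' 0 = i * s ''n'' 0 \<and> (\<forall>j < i. s' ''off'' j = j * s ''n'' 0)"
    for i and s' :: mem
  show ?thesis
    unfolding row_offsets_def
    apply simp
    apply (rule terminates_While[where I = I and lo = 0 and hi = "s ''m'' 0" and N = 3])
    subgoal by (simp add: I_def)
    subgoal by simp
    subgoal by (simp add: I_def)
    subgoal by (simp add: I_def All_less_Suc)
    subgoal by (simp add: I_def)
    subgoal by (simp add: I_def)
    subgoal by simp
    done
qed

lemma terminates_partition_by_vertex:
  fixes s :: mem
  defines "c \<equiv> s ''c'' 0" and "m \<equiv> s ''m'' 0" and "v \<equiv> s ''v'' 0"
  assumes "c \<le> m"
  shows "terminates partition_by_vertex s (3 + 7 * m)
     (\<lambda>s'. unchanged {''off'', ''d'', ''j'', ''t''} s s' \<and> c \<le> s' ''d'' 0 \<and> s' ''d'' 0 \<le> m \<and>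
        (\<exists>\<pi>. \<pi> permutes {c..<m} \<and> s' ''off'' = s ''off'' \<circ> \<pi>) \<and>
        (\<forall>l. c \<le> l \<longrightarrow> l < m \<longrightarrow> (s ''inc'' (s' ''off'' l + v) \<noteq> 0 \<longleftrightarrow> l < s' ''d'' 0)))"
proof -
  define I where "I i s' \<longleftrightarrow> unchanged {''off'', ''d'', ''j'', ''t''} s s' \<and> s' ''j'' 0 = i \<and>
      c \<le> s' ''d'' 0 \<and> s' ''d'' 0 \<le> i \<and>
      (\<exists>\<pi>. \<pi> permutes {c..<m} \<and> s' ''off'' = s ''off'' \<circ> \<pi>) \<and>
      (\<forall>l. c \<le> l \<longrightarrow> l < i \<longrightarrow> (s ''inc'' (s' ''off'' l + v) \<noteq> 0 \<longleftrightarrow> l < s' ''d'' 0))"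
    for i and s' :: mem
  show ?thesis
    unfolding partition_by_vertex_def
    apply simp
    apply (rule terminates_While[where I = I and lo = c and hi = m and N = 6])
    subgoal by (auto simp: I_def c_def intro!: exI[of _ id] permutes_id)
    subgoal by (rule \<open>c \<le> m\<close>)
    subgoal by (simp add: I_def m_def)
    subgoal premises prems for i s'
    proof -
      have u: "unchanged {''off'', ''d'', ''j'', ''t''} s s'" and j: "s' ''j'' 0 = i"
        and d: "c \<le> s' ''d'' 0" "s' ''d'' 0 \<le> i"
        and ex: "\<exists>\<pi>. \<pi> permutes {c..<m} \<and> s' ''off'' = s ''off'' \<circ> \<pi>"
        using prems(3) by (simp_all add: I_def)
      have off: "s ''inc'' (s' ''off'' l + v) \<noteq> 0 \<longleftrightarrow> l < s' ''d'' 0" if "c \<le> l" "l < i" for l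
        using prems(3) that unfolding I_def by blast
      from ex obtain \<pi> where \<pi>: "\<pi> permutes {c..<m}" "s' ''off'' = s ''off'' \<circ> \<pi>"
        by blast
      show ?thesis
      proof (cases "s ''inc'' (s' ''off'' i + v) = 0")
        case True
        have "\<forall>l. c \<le> l \<longrightarrow> l < Suc i \<longrightarrow> (s ''inc'' (s' ''off'' l + v) \<noteq> 0 \<longleftrightarrow> l < s' ''d'' 0)"
          using off True d(2) by (metis less_antisym not_le)
        then have "I (Suc i) (s'(''j'' := (s' ''j'')(0 := Suc i)))"
          unfolding I_def using u d ex by simp
        then show ?thesis
          using True u j by (simp add: v_def)
      next
        case False
        let ?d = "s' ''d'' 0"
        define f where "f = (s' ''off'')(i := s' ''off'' ?d, ?d := s' ''off'' i)"
        have f: "f = s ''off'' \<circ> (\<pi> \<circ> transpose ?d i)"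
          unfolding f_def \<pi>(2) by (auto simp: fun_eq_iff transpose_def)
        have "transpose ?d i permutes {c..<m}"
          using d prems(1,2) by (intro permutes_swap_id) auto
        then have p: "\<pi> \<circ> transpose ?d i permutes {c..<m}"
          using \<pi>(1) by (rule permutes_compose)
        then have ex': "\<exists>\<pi>. \<pi> permutes {c..<m} \<and> f = s ''off'' \<circ> \<pi>"
          using f by blast
        have f_inc: "s ''inc'' (f l + v) \<noteq> 0 \<longleftrightarrow> l < Suc ?d" if l: "c \<le> l" "l < Suc i" for l
        proof -
          consider "l = ?d" | "l = i" "l \<noteq> ?d" | "l < i" "l \<noteq> ?d" "l \<noteq> i"
            using l by linarith
          then show ?thesis
          proof cases
            case 1
            then show ?thesis using False by (simp add: f_def)
          next
            \<comment> \<open>Position \<open>d\<close> lies below \<open>i\<close>, so the edge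
              swapped up from it was inspected before and does not contain \<open>v\<close>.\<close>
            case 2
            then show ?thesis using off[of ?d] d by (simp add: f_def)
          next
            case 3
            then show ?thesis using off[of l] l by (auto simp: f_def)
          qed
        qed
        have "I (Suc i) (s'(''t'' := t, ''off'' := f, ''d'' := (s' ''d'')(0 := Suc ?d), ''j'' := (s' ''j'')(0 := Suc i)))" for t
          unfolding I_def using u d f_inc ex' by simp
        from this[of "(s' ''t'')(0 := s' ''off'' i)"] show ?thesis
          using False u j by (simp add: v_def f_def fun_upd_twist)
      qed
    qed
    subgoal by (simp add: I_def m_def)
    subgoal by (simp add: I_def)
    subgoal using \<open>c \<le> m\<close> by (simp add: m_def)
    done
qed

lemma terminates_greedy:
  fixes s :: mem
  defines "m \<equiv> s ''m'' 0" and "n \<equiv> s ''n'' 0"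
  shows "terminates greedy s (3 + n * (7 + 7 * m))
     (\<lambda>s'. unchanged {''off'', ''d'', ''j'', ''t'', ''c'', ''v''} s s' \<and> s' ''c'' 0 \<le> m \<and>
        (\<exists>\<pi>. \<pi> permutes {..<m} \<and> s' ''off'' = s ''off'' \<circ> \<pi>) \<and>
        (\<exists>S. S \<subseteq> {..<n} \<and> 2 * card S \<le> s' ''c'' 0 \<and>
          (\<forall>j < s' ''c'' 0. \<exists>u\<in>S. s ''inc'' (s' ''off'' j + u) \<noteq> 0)) \<and>
        (\<forall>u < n. \<forall>i\<in>{s' ''c'' 0..<m}. \<forall>j\<in>{s' ''c'' 0..<m}.
          s ''inc'' (s' ''off'' i + u) \<noteq> 0 \<longrightarrow> s ''inc'' (s' ''off'' j + u) \<noteq> 0 \<longrightarrow> i = j))"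
proof -
  \<comment> \<open>The invariant of the pass after the vertices below \<open>w\<close>, freed from
    the memory. \<open>S\<close> is the set of accepted vertices, and the last conjunct says that no
    treated vertex hits two unhit edges.\<close>
  define G where "G w c off \<longleftrightarrow>
      c \<le> m \<and> (\<exists>\<pi>. \<pi> permutes {..<m} \<and> off = s ''off'' \<circ> \<pi>) \<and>
      (\<exists>S. S \<subseteq> {..<w} \<and> 2 * card S \<le> c \<and> (\<forall>j < c. \<exists>u\<in>S. s ''inc'' (off j + u) \<noteq> 0)) \<and>
      (\<forall>u < w. \<forall>i\<in>{c..<m}. \<forall>j\<in>{c..<m}.
         s ''inc'' (off i + u) \<noteq> 0 \<longrightarrow> s ''inc'' (off j + u) \<noteq> 0 \<longrightarrow> i = j)"
    for w c :: nat and off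
  define I where "I w s' \<longleftrightarrow> unchanged {''off'', ''d'', ''j'', ''t'', ''c'', ''v''} s s' \<and>
      s' ''v'' 0 = w \<and> G w (s' ''c'' 0) (s' ''off'')" for w and s' :: mem
  have step: "G (Suc w) (if d > c + 1 then d else c) (off \<circ> \<pi>)"
    if "G w c off" and d: "c \<le> d" "d \<le> m" and \<pi>: "\<pi> permutes {c..<m}"
      and dw: "\<And>l. c \<le> l \<Longrightarrow> l < m \<Longrightarrow> s ''inc'' ((off \<circ> \<pi>) l + w) \<noteq> 0 \<longleftrightarrow> l < d"
    for w c d off \<pi>
  proof -
    from \<open>G w c off\<close> obtain \<rho> S where c: "c \<le> m"
      and \<rho>: "\<rho> permutes {..<m}" "off = s ''off'' \<circ> \<rho>"
      and S: "S \<subseteq> {..<w}" "2 * card S \<le> c" "\<And>j. j < c \<Longrightarrow> \<exists>u\<in>S. s ''inc'' (off j + u) \<noteq> 0"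
      and uniq: "\<And>u i j. u < w \<Longrightarrow> i \<in> {c..<m} \<Longrightarrow> j \<in> {c..<m} \<Longrightarrow>
        s ''inc'' (off i + u) \<noteq> 0 \<Longrightarrow> s ''inc'' (off j + u) \<noteq> 0 \<Longrightarrow> i = j"
      unfolding G_def by blast
    have perm: "\<exists>\<sigma>. \<sigma> permutes {..<m} \<and> off \<circ> \<pi> = s ''off'' \<circ> \<sigma>"
    proof (intro exI conjI)
      have "\<pi> permutes {..<m}"
        using \<pi> by (rule permutes_subset) auto
      then show "\<rho> \<circ> \<pi> permutes {..<m}"
        using \<rho>(1) by (rule permutes_compose)
    qed (simp add: \<rho>(2) comp_assoc)
    have S': "\<exists>u\<in>S. s ''inc'' ((off \<circ> \<pi>) j + u) \<noteq> 0" if "j < c" for j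
      using S(3)[OF that] permutes_not_in[OF \<pi>, of j] that by simp
    have uniq': "i = j" if "u < w" "i \<in> {c..<m}" "j \<in> {c..<m}"
        "s ''inc'' ((off \<circ> \<pi>) i + u) \<noteq> 0" "s ''inc'' ((off \<circ> \<pi>) j + u) \<noteq> 0" for u i j
    proof -
      have "\<pi> i = \<pi> j"
        using that permutes_in_image[OF \<pi>] by (intro uniq[of u]) auto
      then show ?thesis
        using permutes_inj[OF \<pi>] by (simp add: inj_def)
    qed
    show ?thesis
    proof (cases "d > c + 1")
      case True
      have "finite S"
        using S(1) by (rule finite_subset) simp
      then have "2 * card (insert w S) \<le> d"
        using S(2) True by (simp add: card_insert_if)
      moreover have "insert w S \<subseteq> {..<Suc w}"
        using S(1) by auto
      moreover have "\<exists>u\<in>insert w S. s ''inc'' ((off \<circ> \<pi>) j + u) \<noteq> 0" if "j < d" for j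
        using S'[of j] dw[of j] that d by (cases "j < c") auto
      ultimately have ex: "\<exists>S. S \<subseteq> {..<Suc w} \<and> 2 * card S \<le> d \<and>
          (\<forall>j < d. \<exists>u\<in>S. s ''inc'' ((off \<circ> \<pi>) j + u) \<noteq> 0)"
        by blast
      have "i = j" if "u < Suc w" "i \<in> {d..<m}" "j \<in> {d..<m}"
        "s ''inc'' ((off \<circ> \<pi>) i + u) \<noteq> 0" "s ''inc'' ((off \<circ> \<pi>) j + u) \<noteq> 0" for u i j
      proof (cases "u = w")
        \<comment> \<open>After acceptance no edge from position \<open>d\<close> on contains
          \<open>w\<close>.\<close>
        case True
        then show ?thesis using that dw[of i] d by simp
      next
        case False
        then show ?thesis using that d by (intro uniq'[of u]) auto
      qed
      then have "G (Suc w) d (off \<circ> \<pi>)"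
        unfolding G_def using perm ex d(2) by blast
      then show ?thesis using True by simp
    next
      case False
      have ex: "\<exists>S. S \<subseteq> {..<Suc w} \<and> 2 * card S \<le> c \<and>
          (\<forall>j < c. \<exists>u\<in>S. s ''inc'' ((off \<circ> \<pi>) j + u) \<noteq> 0)"
        using S(1,2) S' by (intro exI[of _ S]) auto
      have "i = j" if "u < Suc w" "i \<in> {c..<m}" "j \<in> {c..<m}"
        "s ''inc'' ((off \<circ> \<pi>) i + u) \<noteq> 0" "s ''inc'' ((off \<circ> \<pi>) j + u) \<noteq> 0" for u i j
      proof (cases "u = w")
        case True
        \<comment> \<open>After rejection the edges containing \<open>w\<close> occupy positions
          from \<open>c\<close> to below \<open>d\<close>, hence at most one.\<close>
        then have "i < d" "j < d"
          using that dw[of i] dw[of j] by simp_all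
        then show ?thesis using that(2,3) \<open>\<not> d > c + 1\<close> by simp
      next
        case False
        then show ?thesis using that by (intro uniq'[of u]) auto
      qed
      then have "G (Suc w) c (off \<circ> \<pi>)"
        unfolding G_def using perm ex c by blast
      then show ?thesis using False by simp
    qed
  qed
  show ?thesis
    unfolding greedy_def
    apply simp
    apply (rule terminates_While[where I = I and lo = 0 and hi = n and N = "6 + 7 * m"])
    subgoal
    proof -
      have "G 0 0 (s ''off'')"
        unfolding G_def by (auto intro!: exI[of _ id] permutes_id)
      then show ?thesis by (simp add: I_def)
    qed
    subgoal by simp
    subgoal by (simp add: I_def n_def)
    subgoal premises prems for w s'
    proof -
      have u: "unchanged {''off'', ''d'', ''j'', ''t'', ''c'', ''v''} s s'"
        and v: "s' ''v'' 0 = w" and G: "G w (s' ''c'' 0) (s' ''off'')"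
        using prems(3) by (simp_all add: I_def)
      have m: "s' ''m'' 0 = m" "s' ''inc'' = s ''inc''"
        using u by (simp_all add: m_def)
      show ?thesis
        apply (rule terminates_Seq[where ?N1.0 = "3 + 7 * m" and ?N2.0 = 3])
         apply (rule terminates_mono[OF terminates_partition_by_vertex])
        subgoal using G m by (simp add: G_def)
        subgoal premises prems' for s''
        proof -
          from prems' obtain \<pi> where
            u': "unchanged {''off'', ''d'', ''j'', ''t''} s' s''"
            and d: "s' ''c'' 0 \<le> s'' ''d'' 0" "s'' ''d'' 0 \<le> m"
            and \<pi>: "\<pi> permutes {s' ''c'' 0..<m}" "s'' ''off'' = s' ''off'' \<circ> \<pi>"
            and dw: "\<And>l. s' ''c'' 0 \<le> l \<Longrightarrow> l < m \<Longrightarrow>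
              s ''inc'' (s'' ''off'' l + w) \<noteq> 0 \<longleftrightarrow> l < s'' ''d'' 0"
            unfolding m v by blast
          have u'': "unchanged {''off'', ''d'', ''j'', ''t'', ''c'', ''v''} s s''"
            and eqs: "s'' ''c'' 0 = s' ''c'' 0" "s'' ''v'' 0 = w"
            using u u' v by simp_all
          have "G (Suc w) (if s'' ''d'' 0 > s' ''c'' 0 + 1 then s'' ''d'' 0 else s' ''c'' 0) (s'' ''off'')"
            using step[OF G d \<pi>(1)] dw unfolding \<pi>(2) by blast
          then show ?thesis
            using u'' eqs by (cases "s'' ''d'' 0 > s' ''c'' 0 + 1") (simp_all add: I_def)
        qed
        subgoal using m by simp
        subgoal by simp
        done
    qed
    subgoal by (simp add: I_def n_def)
    subgoal by (simp add: I_def G_def)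
    subgoal by (simp add: n_def)
    done
qed

subsection \<open>The algorithm\<close>

text \<open>By truncation the test succeeds iff \<open>2 * k \<le> c\<close>.\<close>

definition solver :: com where
  "solver =
     row_offsets ;; greedy ;;
     Cond (Sub (Add (Var ''c'') (Const 1)) (Add (Var ''k'') (Var ''k'')))
       (''out'' ::= Const 1) dynamic_program"

text \<open>The sum of the budgets of the three phases. \<open>4 ^ k\<close> replaces
  \<open>2 ^ c\<close>, since the table is built only if \<open>c < 2 * k\<close>; elsewhere
  \<open>c\<close> is replaced by \<open>m\<close>.\<close>

definition step_bound :: "nat \<Rightarrow> nat \<Rightarrow> nat \<Rightarrow> nat" where
  "step_bound n m k =
     16 + 4 * m + n * (7 + 7 * m) + 3 * m + (m + 1) * (6 + 4 ^ k * (12 + 5 * m + n * (10 + 7 * m)))"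

lemma terminates_solver:
  fixes s :: mem
  defines "n \<equiv> s ''n'' 0" and "m \<equiv> s ''m'' 0" and "k \<equiv> s ''k'' 0"
  assumes coverable: "\<And>j. j < m \<Longrightarrow> \<exists>v<n. s ''inc'' (j * n + v) \<noteq> 0"
  shows "terminates solver s (step_bound n m k)
     (\<lambda>s'. s' ''out'' 0 =
        (if hitting_number (\<lambda>j v. s ''inc'' (j * n + v) \<noteq> 0) {..<n} {..<m} + k \<le> m then 1 else 0))"
proof -
  define inc where "inc = s ''inc''"
  define T where "T = hitting_number (\<lambda>j v. inc (j * n + v) \<noteq> 0) {..<n} {..<m}"
  define R where "R = (m + 1) * (6 + 4 ^ k * (12 + 5 * m + n * (10 + 7 * m)))"
  \<comment> \<open>The budget of \<open>dynamic_program\<close> plus one step for the test in front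
    of it.\<close>
  define D where "D = 10 + 3 * m + R"
  have D: "0 < D" "Suc 0 < D"
    by (simp_all add: D_def)
  show ?thesis
    unfolding solver_def inc_def[symmetric] T_def[symmetric]
    apply (rule terminates_Seq[where ?N1.0 = "3 + 4 * m" and ?N2.0 = "3 + n * (7 + 7 * m) + D"])
     apply (rule terminates_mono[OF terminates_row_offsets])
    subgoal premises prems for s1
    proof -
      have u1: "unchanged {''off'', ''p'', ''j''} s s1"
        and off1: "\<And>j. j < m \<Longrightarrow> s1 ''off'' j = j * n"
        using prems by (simp_all add: m_def n_def)
      have s1: "s1 ''n'' 0 = n" "s1 ''m'' 0 = m" "s1 ''k'' 0 = k" "s1 ''inc'' = inc"
        using u1 by (simp_all add: n_def m_def k_def inc_def)
      show ?thesis
        apply (rule terminates_Seq[where ?N1.0 = "3 + n * (7 + 7 * m)" and ?N2.0 = D])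
         apply (rule terminates_mono[OF terminates_greedy])
        subgoal premises prems' for s2
        proof -
          define c off where "c = s2 ''c'' 0" and "off = s2 ''off''"
          note greedy = prems'[unfolded s1 c_def[symmetric] off_def[symmetric]]
          from greedy have c: "c \<le> m"
            by (elim conjE)
          from greedy have u2: "unchanged {''off'', ''d'', ''j'', ''t'', ''c'', ''v''} s1 s2"
            by (elim conjE)
          from greedy have "\<exists>\<pi>. \<pi> permutes {..<m} \<and> off = s1 ''off'' \<circ> \<pi>"
            by (elim conjE)
          then obtain \<pi> where \<pi>: "\<pi> permutes {..<m}" "off = s1 ''off'' \<circ> \<pi>"
            by blast
          from greedy have "\<exists>S. S \<subseteq> {..<n} \<and> 2 * card S \<le> c \<and>
              (\<forall>j < c. \<exists>u\<in>S. inc (off j + u) \<noteq> 0)"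
            by (elim conjE)
          then obtain S where S: "S \<subseteq> {..<n}" "2 * card S \<le> c" "\<And>j. j < c \<Longrightarrow> \<exists>u\<in>S. inc (off j + u) \<noteq> 0"
            by blast
          from greedy have uniq: "\<forall>u < n. \<forall>i\<in>{c..<m}. \<forall>j\<in>{c..<m}.
              inc (off i + u) \<noteq> 0 \<longrightarrow> inc (off j + u) \<noteq> 0 \<longrightarrow> i = j"
            by (elim conjE)
          have s2: "s2 ''n'' 0 = n" "s2 ''m'' 0 = m" "s2 ''k'' 0 = k" "s2 ''inc'' = inc"
            using u2 by (simp_all add: s1)
          have \<pi>_less: "\<pi> j < m" if "j < m" for j
            using permutes_in_image[OF \<pi>(1), of j] that by simp
          have off: "off j = \<pi> j * n" if "j < m" for j
            using off1[OF \<pi>_less[OF that]] by (simp add: \<pi>(2))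
          interpret partitioned_incidence n m c inc off
          proof
            show "c \<le> m" by (rule c)
          next
            fix j assume "j < m"
            then show "\<exists>v<n. inc (off j + v) \<noteq> 0"
              using coverable[OF \<pi>_less] by (simp add: off inc_def)
          next
            fix v i j assume "v < n" "c \<le> i" "i < m" "c \<le> j" "j < m"
              "inc (off i + v) \<noteq> 0" "inc (off j + v) \<noteq> 0"
            then show "i = j"
              using uniq by simp
          qed
          have "tau {..<m} = hitting_number (\<lambda>j v. inc (\<pi> j * n + v) \<noteq> 0) {..<n} {..<m}"
            by (intro hitting_number_cong) (simp add: off)
          also have "\<dots> = T"
            using hitting_number_image[of "\<lambda>j v. inc (j * n + v) \<noteq> 0" \<pi> "{..<n}" "{..<m}"]
            by (simp add: T_def permutes_image[OF \<pi>(1)])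
          finally have tau: "tau {..<m} = T" .
          show ?thesis
          proof (cases "2 * k \<le> c")
            case True
            have "hits adj {..<n} {..<c} S"
              using S by (auto simp: hits_def)
            then have "tau ({..<c} \<union> {c..<m}) \<le> card S + card {c..<m}"
              by (intro hitting_number_le_add) (use coverable in auto)
            also have "{..<c} \<union> {c..<m} = {..<m}"
              using c by auto
            finally have "T + k \<le> m"
              using S(2) True c tau by simp
            then show ?thesis
              using True by (simp add: s2 c_def D)
          next
            case False
            have "(2::nat) ^ c \<le> 2 ^ (2 * k)"
              using False by (intro power_increasing) auto
            then have pow: "(2::nat) ^ c \<le> 4 ^ k"
              by (simp add: power_mult)
            have bound: "9 + 3 * c + (m + 1) * (6 + 2 ^ c * (12 + 5 * c + n * (10 + 7 * c))) \<le> D - 1"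
            proof -
              have "2 ^ c * (12 + 5 * c + n * (10 + 7 * c)) \<le> 4 ^ k * (12 + 5 * m + n * (10 + 7 * m))"
                using c pow by (intro mult_le_mono add_mono) auto
              then have "(m + 1) * (6 + 2 ^ c * (12 + 5 * c + n * (10 + 7 * c)))
                  \<le> R"
                unfolding R_def by (intro mult_le_mono2 add_left_mono)
              then show ?thesis
                using c unfolding D_def by linarith
            qed
            have "terminates dynamic_program s2 (D - 1) (\<lambda>s'. s' ''out'' 0 = (if T + k \<le> m then 1 else 0))"
              by (rule terminates_mono[OF terminates_dynamic_program[OF _ _ c_def[symmetric] _ off_def[symmetric]]])
                (use bound in \<open>simp_all add: s2 tau[simplified]\<close>)
            then show ?thesis
              using False by (simp add: s2 c_def D)
          qed
        qed
        subgoal by (simp add: s1)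
        subgoal by simp
        done
    qed
    subgoal by (simp add: m_def)
    subgoal by (simp add: D_def R_def step_bound_def)
    done
qed

text \<open>Vertices and edges become list positions. Distinctness of \<open>vs\<close> ensures that
  a vertex set has no more positions than elements. Moving \<open>k\<close> to the left avoids
  truncated subtraction and keeps instances with fewer than \<open>k\<close> edges negative.\<close>

lemma m_minus_k_hitting_set_iff:
  assumes "distinct vs" and "\<And>e. e \<in> set es \<Longrightarrow> e \<noteq> {} \<and> e \<subseteq> set vs"
  shows "m_minus_k_hitting_set (set vs) (mset es) k \<longleftrightarrow>
    hitting_number (\<lambda>j v. vs ! v \<in> es ! j) {..<length vs} {..<length es} + k \<le> length es"
    (is "_ \<longleftrightarrow> hitting_number ?A ?V ?Y + k \<le> _")
proof
  assume "m_minus_k_hitting_set (set vs) (mset es) k"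
  then obtain S where S: "S \<subseteq> set vs" "\<forall>e\<in>set es. e \<inter> S \<noteq> {}" "card S + k \<le> length es"
    by (auto simp: m_minus_k_hitting_set_def hitting_set_def)
  define T where "T = {v. v < length vs \<and> vs ! v \<in> S}"
  have "hits ?A ?V ?Y T"
    unfolding hits_def
  proof (intro conjI ballI)
    fix j assume "j \<in> ?Y"
    then have "es ! j \<inter> S \<noteq> {}"
      using S(2) by simp
    then obtain x where "x \<in> es ! j" "x \<in> S" by blast
    then show "\<exists>v\<in>T. vs ! v \<in> es ! j"
      using S(1) by (fastforce simp: T_def in_set_conv_nth)
  qed (auto simp: T_def)
  then have "hitting_number ?A ?V ?Y \<le> card T"
    by (rule hitting_number_le)
  also have "card T \<le> card S"
  proof (rule card_inj_on_le)
    show "inj_on ((!) vs) T"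
      using assms(1) by (auto simp: T_def inj_on_def nth_eq_iff_index_eq)
    show "(!) vs ` T \<subseteq> S"
      by (auto simp: T_def)
    show "finite S"
      using S(1) finite_subset by blast
  qed
  finally show "hitting_number ?A ?V ?Y + k \<le> length es"
    using S(3) by simp
next
  assume *: "hitting_number ?A ?V ?Y + k \<le> length es"
  have "\<exists>v\<in>?V. ?A j v" if "j \<in> ?Y" for j
    using assms(2)[of "es ! j"] that by (fastforce simp: in_set_conv_nth)
  then have "hits ?A ?V ?Y ?V"
    by (rule hits_all)
  then obtain T where T: "hits ?A ?V ?Y T" "card T = hitting_number ?A ?V ?Y"
    by (rule hitting_number_attained)
  have "finite T"
    using T(1) finite_subset by (auto simp: hits_def)
  then have "card ((!) vs ` T) + k \<le> length es"
    using card_image_le[of T "(!) vs"] T(2) * by simp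
  moreover have "hitting_set (set vs) (mset es) ((!) vs ` T)"
    unfolding hitting_set_def
  proof (intro conjI ballI)
    show "(!) vs ` T \<subseteq> set vs"
      using T(1) by (auto simp: hits_def)
  next
    fix e assume "e \<in># mset es"
    then obtain j where "j < length es" "e = es ! j"
      by (auto simp: in_set_conv_nth)
    then show "e \<inter> (!) vs ` T \<noteq> {}"
      using T(1) by (fastforce simp: hits_def)
  qed
  ultimately show "m_minus_k_hitting_set (set vs) (mset es) k"
    unfolding m_minus_k_hitting_set_def by (intro exI[of _ "(!) vs ` T"]) simp
qed

section \<open>Numerical bounds and the final theorem\<close>

lemma step_bound_le:
  assumes "n \<ge> 1"
  shows "step_bound n m k \<le> 80 * ((m + n) ^ 3 * 4 ^ k)"
proof -
  define M where "M = m + n"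
  have M: "1 \<le> M" "m + 1 \<le> M" "m \<le> M" "n \<le> M"
    using assms by (auto simp: M_def)
  define Z where "Z = M ^ 3 * 4 ^ k"
  have pow: "M ^ i \<le> M ^ j" if "i \<le> j" for i j
    using that M(1) by (rule power_increasing)
  have le_Z: "M ^ i \<le> Z" if "i \<le> 3" for i
    using mult_le_mono[OF pow[OF that], of 1 "4 ^ k"] by (simp add: Z_def)
  have nm: "n * m \<le> M ^ 2"
    using mult_le_mono[OF M(4,3)] by (simp add: power2_eq_square)
  have Z: "1 \<le> Z" "M \<le> Z" "M ^ 2 \<le> Z"
    using le_Z[of 0] le_Z[of 1] le_Z[of 2] by simp_all
  have "n * (7 + 7 * m) \<le> 14 * Z"
    using nm M Z by (simp add: algebra_simps)
  moreover have "(m + 1) * (6 + 4 ^ k * (12 + 5 * m + n * (10 + 7 * m))) \<le> 40 * Z"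
  proof -
    have M2: "1 \<le> M ^ 2" "M \<le> M ^ 2"
      using pow[of 0 2] pow[of 1 2] by simp_all
    have "12 + 5 * m + n * (10 + 7 * m) = 12 + 5 * m + 10 * n + 7 * (n * m)"
      by (simp add: algebra_simps)
    \<comment> \<open>34 is 12 + 5 + 10 + 7, every monomial being at most
      \<open>M ^ 2\<close>.\<close>
    also have "\<dots> \<le> 34 * M ^ 2"
      using nm M M2 by linarith
    finally have "(m + 1) * (6 + 4 ^ k * (12 + 5 * m + n * (10 + 7 * m))) \<le> M * (6 + 4 ^ k * (34 * M ^ 2))"
      using M(2) by (intro mult_le_mono add_mono) auto
    also have "\<dots> = 6 * M + 34 * Z"
      by (simp add: Z_def algebra_simps power2_eq_square power3_eq_cube)
    finally show ?thesis
      using Z by linarith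
  qed
  \<comment> \<open>The summands contribute 16, 4, 14, 3 and 40 times \<open>Z\<close>, together
    77.\<close>
  ultimately show ?thesis
    unfolding step_bound_def Z_def[symmetric] M_def[symmetric] using M Z by linarith
qed

theorem theorem3:
  "\<exists>(p :: com) (g :: nat \<Rightarrow> real) (C :: real) (d :: nat).
     g \<in> O(\<lambda>k. (ln (real k))\<^sup>2) \<and>
     (\<forall>(V :: 'a set) E k s.
        hypergraph V E \<longrightarrow> k > 0 \<longrightarrow> represents s V E k \<longrightarrow>
        (\<exists>t. answers p s (m_minus_k_hitting_set V E k) t \<and>
             real t \<le> C * (2 * exp 1) powr (2 * real k + g k) * real (size E + card V) ^ d))"
proof -
  define W where "W = csize solver"
  \<comment> \<open>From \<open>N \<le> 80 * Z\<close> below: \<open>Z * (4 + 81 * W)\<close> bounds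
    the charge for a unit of size, where 4 pays for 2, \<open>n + m\<close> and \<open>k\<close>,
    and 81 for \<open>N * W\<close> and \<open>W\<close>. The factor 80 is that of \<open>N\<close>
    itself.\<close>
  define C where "C = 80 * (1 + W * (4 + 81 * W))"
  have "\<exists>t. answers solver s (m_minus_k_hitting_set V E k) t \<and>
      real t \<le> real C * (2 * exp 1) powr (2 * real k + 0) * real (size E + card V) ^ 6"
    if "hypergraph V E" and "represents s V E k" for V :: "'a set" and E k s
  proof -
    interpret hypergraph V E by fact
    obtain vs es where vs: "distinct vs" "set vs = V" and es: "mset es = E" and s: "s = encode vs es k"
      using \<open>represents s V E k\<close> by (auto simp: represents_def)
    define n m where "n = length vs" and "m = length es"
    have n: "n \<ge> 1"
      using vertices_nonempty vs(2) by (cases vs) (auto simp: n_def)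
    have n_card: "n = card V" and m_size: "m = size E"
      using vs es distinct_card[OF vs(1)] by (auto simp: n_def m_def)
    have edges: "e \<noteq> {} \<and> e \<subseteq> set vs" if "e \<in> set es" for e
      using edge_nonempty[of e] edge_subset[of e] that es vs(2) by auto
    have s_eqs: "s ''n'' 0 = n" "s ''m'' 0 = m" "s ''k'' 0 = k"
      by (simp_all add: s encode_def n_def m_def)
    have inc: "s ''inc'' (j * n + v) \<noteq> 0 \<longleftrightarrow> vs ! v \<in> es ! j" if "j < m" "v < n" for j v
    proof -
      have "j * n + v < Suc j * n"
        using that by simp
      also have "\<dots> \<le> m * n"
        using that by (intro mult_le_mono) auto
      finally show ?thesis
        using that by (simp add: s encode_def n_def[symmetric] m_def[symmetric])
    qed
    have coverable: "\<exists>v<s ''n'' 0. s ''inc'' (j * s ''n'' 0 + v) \<noteq> 0" if "j < s ''m'' 0" for j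
    proof -
      have j: "j < m" using that by (simp add: s_eqs)
      then obtain x where "x \<in> es ! j" "x \<in> set vs"
        using edges[of "es ! j"] by (fastforce simp: m_def)
      then obtain v where "v < n" "vs ! v \<in> es ! j"
        by (auto simp: in_set_conv_nth n_def)
      then show ?thesis
        using inc[OF j] by (auto simp: s_eqs)
    qed
    have "hitting_number (\<lambda>j v. s ''inc'' (j * n + v) \<noteq> 0) {..<n} {..<m} =
        hitting_number (\<lambda>j v. vs ! v \<in> es ! j) {..<n} {..<m}"
      by (intro hitting_number_cong inc) auto
    then have correct: "m_minus_k_hitting_set V E k \<longleftrightarrow>
        hitting_number (\<lambda>j v. s ''inc'' (j * n + v) \<noteq> 0) {..<n} {..<m} + k \<le> m"
      using m_minus_k_hitting_set_iff[of vs es k, OF vs(1) edges] by (simp add: vs(2) es n_def m_def)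
    define N where "N = step_bound n m k"
    have le_pow: "x \<le> 2 ^ (n + m + k)" if "x \<le> n + m + k" for x
      using that less_exp[of "n + m + k"] by linarith
    \<comment> \<open>A linear exponent is far above the true bit length of the input, but it is
      dominated by the step count bound anyway.\<close>
    have "s x i \<le> 2 ^ (n + m + k)" for x i
      by (simp add: s encode_def n_def[symmetric] m_def[symmetric] le_pow)
    from terminates_imp_exec[OF terminates_solver[OF coverable] this]
    obtain t s' where t: "exec solver s t s'" "t \<le> N * (1 + W * (2 + (n + m + k + N * W) + W))"
      and s': "s' ''out'' 0 = (if m_minus_k_hitting_set V E k then 1 else 0)"
      unfolding s_eqs correct N_def W_def by blast
    define Z where "Z = (m + n) ^ 3 * 4 ^ k"
    have "(m + n) ^ 1 \<le> (m + n) ^ 3"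
      using n by (intro power_increasing) auto
    then have "(m + n) * 1 \<le> Z"
      unfolding Z_def using n by (intro mult_le_mono) auto
    moreover have "1 * k \<le> Z"
      unfolding Z_def using n less_exp[of k] power_mono[of 2 "4::nat" k]
      by (intro mult_le_mono) (auto intro: order.trans less_imp_le)
    moreover have "1 \<le> Z"
      unfolding Z_def using n by simp
    moreover have "N \<le> 80 * Z"
      unfolding N_def Z_def by (rule step_bound_le[OF n])
    ultimately have Z: "m + n \<le> Z" "k \<le> Z" "1 \<le> Z" "N \<le> 80 * Z"
      by simp_all
    have "N * W \<le> 80 * (Z * W)"
      using mult_le_mono1[OF Z(4), of W] by simp
    moreover have "W \<le> Z * W"
      using Z(3) by simp
    moreover have "Z * (4 + 81 * W) = 4 * Z + Z * W + 80 * (Z * W)"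
      by (simp add: algebra_simps)
    ultimately have "2 + (n + m + k + N * W) + W \<le> Z * (4 + 81 * W)"
      using Z(1-3) by linarith
    then have "1 + W * (2 + (n + m + k + N * W) + W) \<le> Z + W * (Z * (4 + 81 * W))"
      using Z(3) by (intro add_mono mult_le_mono) auto
    then have "N * (1 + W * (2 + (n + m + k + N * W) + W)) \<le> (80 * Z) * (Z + W * (Z * (4 + 81 * W)))"
      using Z(4) by (intro mult_le_mono)
    also have "\<dots> = C * Z ^ 2"
      by (simp add: C_def algebra_simps power2_eq_square)
    finally have "t \<le> C * Z ^ 2"
      using t(2) by linarith
    then have "real t \<le> real C * (real (m + n) ^ 6 * 16 ^ k)"
    proof -
      have "Z ^ 2 = (m + n) ^ 6 * 16 ^ k"
        by (simp add: Z_def power_mult_distrib flip: power_mult) (simp add: power_mult mult.commute[of k])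
      then have "real C * (real (m + n) ^ 6 * 16 ^ k) = real (C * Z ^ 2)"
        by simp
      then show ?thesis
        using \<open>t \<le> C * Z ^ 2\<close> by (simp only: of_nat_le_iff)
    qed
    also have "\<dots> \<le> real C * (real (m + n) ^ 6 * (2 * exp 1) powr (2 * real k + 0))"
    proof -
      have "(16::real) ^ k = 4 ^ (2 * k)"
        by (simp add: power_mult)
      also have "\<dots> = 4 powr real (2 * k)"
        by (rule powr_realpow[symmetric]) simp
      \<comment> \<open>\<open>1 + 1 \<le> exp 1\<close> gives \<open>4 \<le> 2 * exp 1\<close>, so
        no correction to the exponent is needed.\<close>
      also have "\<dots> \<le> (2 * exp 1) powr (2 * real k + 0)"
        using exp_ge_add_one_self[of 1] by (simp add: powr_mono2)
      finally show ?thesis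
        by (intro mult_left_mono) auto
    qed
    finally have "real t \<le> real C * (2 * exp 1) powr (2 * real k + 0) * real (size E + card V) ^ 6"
      by (simp only: n_card m_size mult.assoc mult.commute[of "_ ^ 6"])
    moreover have "answers solver s (m_minus_k_hitting_set V E k) t"
      unfolding answers_def using t(1) s' by blast
    ultimately show ?thesis
      by blast
  qed
  moreover have "(\<lambda>_. 0) \<in> O(\<lambda>k. (ln (real k))\<^sup>2)"
    by simp
  ultimately show ?thesis
    by (intro exI[of _ solver] exI[of _ "\<lambda>_. 0 :: real"] exI[of _ "real C"] exI[of _ 6]) blast
qed

end
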